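(* Let $H$ be a complex Hilbert space, let $L$ be a locally compact Hausdorff space whose topology is denoted by $\tau$, and let $D$ be a derivation on $C_0(L,B(H))$. Then there exists a bounded function $Z_0:L\to B(H)$ which is $\tau$-to-norm continuous (that is, $Z_0\in M(C_0(L,B(H)))$), with $\|Z_0\|\leq2\|D\|$ and $D(X)=[Z_0,X]$ for every $X\in C_0(L,B(H))$.
   Context: $B(H)$ is the algebra of bounded operators on $H$. $C_0(L,B(H))$ is the C$^*$-algebra of all norm-continuous functions $L\to B(H)$ vanishing at infinity, with pointwise operations and the supremum norm. Its multiplier algebra $M(C_0(L,B(H)))$ is identified with the C$^*$-algebra $C_b(L,B(H))$ of bounded norm-continuous functions $L\to B(H)$. $\|Z_0\|=\sup_{t\in L}\|Z_0(t)\|$ and $[Z_0,X](t)=Z_0(t)X(t)-X(t)Z_0(t)$. A derivation on a C$^*$-algebra $B$ is a linear map $D:B\to B$ with $D(ab)=D(a)b+aD(b)$ for all $a,b\in B$ (automatically bounded). *)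

theory Defs
  imports "HOL-Analysis.Analysis"
begin

text \<open>Complex Hilbert spaces. The real normed structure is inherited from the library; the axioms tie
  it to the complex scalar multiplication and to the norm induced by the inner product, which is
  linear in its first argument.\<close>

class complex_inner = real_normed_vector +
  fixes scaleC :: "complex \<Rightarrow> 'a \<Rightarrow> 'a" (infixr \<open>*\<^sub>C\<close> 75)
    and cinner :: "'a \<Rightarrow> 'a \<Rightarrow> complex"
  assumes scaleC_add_right: "a *\<^sub>C (x + y) = a *\<^sub>C x + a *\<^sub>C y"
    and scaleC_add_left: "(a + b) *\<^sub>C x = a *\<^sub>C x + b *\<^sub>C x"
    and scaleC_scaleC: "a *\<^sub>C (b *\<^sub>C x) = (a * b) *\<^sub>C x"
    and scaleC_of_real: "complex_of_real r *\<^sub>C x = r *\<^sub>R x"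
    and cinner_commute: "cinner x y = cnj (cinner y x)"
    and cinner_add_left: "cinner (x + y) z = cinner x z + cinner y z"
    and cinner_scaleC_left: "cinner (a *\<^sub>C x) y = a * cinner x y"
    and cinner_norm: "cinner x x = complex_of_real ((norm x)\<^sup>2)"

class chilbert_space = complex_inner + complete_space

lemma norm_scaleC: "norm (a *\<^sub>C x) = cmod a * norm (x :: 'a :: complex_inner)"
proof -
  have "cinner (a *\<^sub>C x) (a *\<^sub>C x) = a * cnj (a * cinner x x)"
    by (metis cinner_commute cinner_scaleC_left)
  also have "\<dots> = complex_of_real ((cmod a * norm x)\<^sup>2)"
    by (simp add: cinner_norm power_mult_distrib complex_norm_square mult_ac del: of_real_power)
  finally have "(norm (a *\<^sub>C x))\<^sup>2 = (cmod a * norm x)\<^sup>2"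
    by (simp only: cinner_norm of_real_eq_iff)
  then show ?thesis
    by (simp add: power2_eq_iff_nonneg)
qed

lift_definition scaleC_blinfun ::
    "complex \<Rightarrow> ('a::real_normed_vector \<Rightarrow>\<^sub>L 'b::complex_inner) \<Rightarrow> ('a \<Rightarrow>\<^sub>L 'b)"
  is "\<lambda>a f x. a *\<^sub>C f x"
proof -
  fix a and f :: "'a \<Rightarrow> 'b"
  assume f: "bounded_linear f"
  have "bounded_linear (\<lambda>y::'b. a *\<^sub>C y)"
  proof (rule bounded_linear_intro)
    show "a *\<^sub>C (r *\<^sub>R y) = r *\<^sub>R (a *\<^sub>C y)" for r and y :: 'b
      by (simp add: scaleC_of_real [symmetric] scaleC_scaleC mult.commute)
    show "norm (a *\<^sub>C y) \<le> norm y * cmod a" for y :: 'b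
      by (simp add: norm_scaleC)
  qed (rule scaleC_add_right)
  from bounded_linear_compose [OF this f] show "bounded_linear (\<lambda>x. a *\<^sub>C f x)" .
qed

text \<open>$B(H)$, as the complex linear elements of the library's space of bounded real linear maps;
  the norm of that space is the operator norm.\<close>

definition bounded_operators :: "('h::chilbert_space \<Rightarrow>\<^sub>L 'h) set" where
  "bounded_operators =
    {T. \<forall>a x. blinfun_apply T (a *\<^sub>C x) = a *\<^sub>C blinfun_apply T x}"

text \<open>The space is the carrier of a topology on a type. A function on the carrier is represented by
  the total function extending it by 0, so that equality of representatives is equality on the
  carrier; pointwise operations preserve this convention.\<close>

definition C_b :: "'l topology \<Rightarrow> ('l \<Rightarrow> 'h::chilbert_space \<Rightarrow>\<^sub>L 'h) set" where
  "C_b L = {Z. continuous_map L euclidean Z \<and>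
               Z ` topspace L \<subseteq> bounded_operators \<and>
               bounded (Z ` topspace L) \<and>
               (\<forall>t. t \<notin> topspace L \<longrightarrow> Z t = 0)}"

definition C_0 :: "'l topology \<Rightarrow> ('l \<Rightarrow> 'h::chilbert_space \<Rightarrow>\<^sub>L 'h) set" where
  "C_0 L = {X. continuous_map L euclidean X \<and>
               X ` topspace L \<subseteq> bounded_operators \<and>
               (\<forall>e>0. \<exists>K. compactin L K \<and> (\<forall>t \<in> topspace L - K. norm (X t) < e)) \<and>
               (\<forall>t. t \<notin> topspace L \<longrightarrow> X t = 0)}"

text \<open>Inserting 0 changes nothing for a nonempty space and gives norm 0 on the empty one.\<close>

definition sup_norm :: "'l topology \<Rightarrow> ('l \<Rightarrow> 'h::chilbert_space \<Rightarrow>\<^sub>L 'h) \<Rightarrow> real" where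
  "sup_norm L F = Sup (insert 0 ((\<lambda>t. norm (F t)) ` topspace L))"

definition derivation_C_0 ::
    "'l topology \<Rightarrow> (('l \<Rightarrow> 'h::chilbert_space \<Rightarrow>\<^sub>L 'h) \<Rightarrow> ('l \<Rightarrow> 'h \<Rightarrow>\<^sub>L 'h)) \<Rightarrow> bool" where
  "derivation_C_0 L D \<longleftrightarrow>
    D ` C_0 L \<subseteq> C_0 L \<and>
    (\<forall>X \<in> C_0 L. \<forall>Y \<in> C_0 L. D (\<lambda>t. X t + Y t) = (\<lambda>t. D X t + D Y t)) \<and>
    (\<forall>a. \<forall>X \<in> C_0 L. D (\<lambda>t. scaleC_blinfun a (X t)) = (\<lambda>t. scaleC_blinfun a (D X t))) \<and>
    (\<forall>X \<in> C_0 L. \<forall>Y \<in> C_0 L.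
       D (\<lambda>t. X t o\<^sub>L Y t) = (\<lambda>t. (D X t o\<^sub>L Y t) + (X t o\<^sub>L D Y t)))"

text \<open>The operator norm with respect to the supremum norm. The real supremum is meaningful because
  derivations on C*-algebras are automatically bounded.\<close>

definition operator_norm ::
    "'l topology \<Rightarrow> (('l \<Rightarrow> 'h::chilbert_space \<Rightarrow>\<^sub>L 'h) \<Rightarrow> ('l \<Rightarrow> 'h \<Rightarrow>\<^sub>L 'h)) \<Rightarrow> real" where
  "operator_norm L D = Sup {sup_norm L (D X) | X. X \<in> C_0 L \<and> sup_norm L X \<le> 1}"

definition commutator ::
    "('l \<Rightarrow> 'h::chilbert_space \<Rightarrow>\<^sub>L 'h) \<Rightarrow> ('l \<Rightarrow> 'h \<Rightarrow>\<^sub>L 'h) \<Rightarrow> ('l \<Rightarrow> 'h \<Rightarrow>\<^sub>L 'h)" where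
  "commutator Z X = (\<lambda>t. (Z t o\<^sub>L X t) - (X t o\<^sub>L Z t))"

end

theory Submission
  imports Defs
begin

text \<open>An element of \<open>C_0\<close> vanishing at \<open>t\<close> is a product of two such elements, so \<open>D X t\<close>
  depends only on \<open>X t\<close>, and \<open>D\<close> decomposes into derivations \<open>\<delta>\<^sub>t\<close> of \<open>B(H)\<close>. For a unit vector
  \<open>e\<close>, the operator \<open>Z\<^sub>t x = \<delta>\<^sub>t (x \<otimes> e) e\<close> implements \<open>\<delta>\<^sub>t\<close>, and its norm is at most that of \<open>D\<close>
  once \<open>D\<close> is known to be bounded; this follows from uniform boundedness applied to the vectors
  \<open>Z\<^sub>t x\<close> with \<open>\<parallel>x\<parallel> \<le> 1\<close>. By construction \<open>t \<mapsto> Z\<^sub>t\<close> and its adjoint are only strongly continuous. If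
  norm continuity failed at \<open>t\<close>, a gliding hump would produce points \<open>s\<^sub>n\<close> in a compact neighbourhood
  of \<open>t\<close> and one operator \<open>T\<close> for which the \<open>\<delta>\<^sub>s T\<close> with \<open>s = s\<^sub>n\<close> are uniformly separated, although
  \<open>s \<mapsto> \<delta>\<^sub>s T\<close> is norm continuous.\<close>

subsection \<open>Complex Hilbert spaces\<close>

\<comment> \<open>Opens the convergence theorems for series, by which the limit vector in the
  uniform boundedness argument and the shift operator are built.\<close>
subclass (in chilbert_space) banach ..

lemma cinner_add_right: "cinner x (y + z) = cinner x y + cinner x (z :: 'a :: complex_inner)"
  by (metis cinner_add_left cinner_commute complex_cnj_add)

lemma cinner_scaleC_right: "cinner x (a *\<^sub>C y) = cnj a * cinner x (y :: 'a :: complex_inner)"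
  by (metis cinner_commute cinner_scaleC_left complex_cnj_mult)

lemma cinner_scaleR_left: "cinner (r *\<^sub>R x) y = of_real r * cinner x (y :: 'a :: complex_inner)"
  by (metis cinner_scaleC_left scaleC_of_real)

lemma cinner_scaleR_right: "cinner x (r *\<^sub>R y) = of_real r * cinner x (y :: 'a :: complex_inner)"
  by (metis cinner_scaleC_right scaleC_of_real complex_cnj_complex_of_real)

lemma cinner_zero_left [simp]: "cinner 0 y = (0 :: complex)" for y :: "'a :: complex_inner"
  using cinner_scaleR_left[of 0 0 y] by simp

lemma cinner_zero_right [simp]: "cinner y 0 = (0 :: complex)" for y :: "'a :: complex_inner"
  using cinner_scaleR_right[of y 0 0] by simp

lemma cinner_minus_left: "cinner (- x) y = - cinner x (y :: 'a :: complex_inner)"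
  using cinner_scaleR_left[of "-1" x y] by simp

lemma cinner_minus_right: "cinner x (- y) = - cinner x (y :: 'a :: complex_inner)"
  using cinner_scaleR_right[of x "-1" y] by simp

lemma cinner_diff_left: "cinner (x - y) z = cinner x z - cinner y (z :: 'a :: complex_inner)"
  using cinner_add_left[of x "-y" z] by (simp add: cinner_minus_left)

lemma cinner_diff_right: "cinner x (y - z) = cinner x y - cinner x (z :: 'a :: complex_inner)"
  using cinner_add_right[of x y "-z"] by (simp add: cinner_minus_right)

lemma cinner_sum_left: "cinner (\<Sum>i\<in>A. f i) z = (\<Sum>i\<in>A. cinner (f i) (z :: 'a :: complex_inner))"
  by (induction A rule: infinite_finite_induct) (simp_all add: cinner_add_left)

lemma cinner_sum_right: "cinner z (\<Sum>i\<in>A. f i) = (\<Sum>i\<in>A. cinner (z :: 'a :: complex_inner) (f i))"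
  by (induction A rule: infinite_finite_induct) (simp_all add: cinner_add_right)

lemma scaleC_zero_left [simp]: "0 *\<^sub>C x = (0 :: 'a :: complex_inner)"
  using scaleC_of_real[of 0 x] by simp

lemma scaleC_one [simp]: "1 *\<^sub>C x = (x :: 'a :: complex_inner)"
  using scaleC_of_real[of 1 x] by simp

lemma scaleC_zero_right [simp]: "a *\<^sub>C 0 = (0 :: 'a :: complex_inner)"
  using scaleC_add_right[of a 0 "0 :: 'a"] by simp

lemma scaleC_minus_right: "a *\<^sub>C (- x) = - (a *\<^sub>C (x :: 'a :: complex_inner))"
  using scaleC_add_right[of a x "-x"] by (simp add: eq_neg_iff_add_eq_0 add.commute)

lemma scaleC_diff_right: "a *\<^sub>C (x - y) = a *\<^sub>C x - a *\<^sub>C (y :: 'a :: complex_inner)"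
  using scaleC_add_right[of a x "-y"] by (simp add: scaleC_minus_right)

lemma scaleC_scaleR: "a *\<^sub>C (r *\<^sub>R x) = r *\<^sub>R (a *\<^sub>C (x :: 'a :: complex_inner))"
  by (metis scaleC_of_real scaleC_scaleC mult.commute)

text \<open>With \<open>c *\<^sub>C y\<close> the orthogonal projection of \<open>x\<close> on
  \<open>y\<close>, the remainder has squared norm |x|^2 - |c|^2 |y|^2, which is therefore
  nonnegative.\<close>

lemma complex_Cauchy_Schwarz: "cmod (cinner x y) \<le> norm x * norm (y :: 'a :: complex_inner)"
proof (cases "y = 0")
  case False
  define c where "c = cinner x y / of_real ((norm y)\<^sup>2)"
  have ny: "norm y > 0" using False by simp
  have cy: "c * of_real ((norm y)\<^sup>2) = cinner x y" using ny by (simp add: c_def)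
  have cc: "cinner x (c *\<^sub>C y) = of_real ((cmod c)\<^sup>2 * (norm y)\<^sup>2)"
    by (simp add: cinner_scaleC_right cy[symmetric] complex_norm_square[symmetric] mult_ac)
  have "cinner (x - c *\<^sub>C y) (x - c *\<^sub>C y) = cinner x x - cinner x (c *\<^sub>C y)"
  proof -
    have "cinner (c *\<^sub>C y) (x - c *\<^sub>C y) = 0"
    proof -
      have "cinner (x - c *\<^sub>C y) y = 0"
        by (simp only: cinner_diff_left cinner_scaleC_left cinner_norm cy) simp
      then have "cinner y (x - c *\<^sub>C y) = 0"
        by (metis cinner_commute complex_cnj_zero)
      then show ?thesis by (simp add: cinner_scaleC_left)
    qed
    then show ?thesis by (simp add: cinner_diff_left) (simp add: cinner_diff_right)
  qed
  then have "complex_of_real ((norm (x - c *\<^sub>C y))\<^sup>2)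
      = of_real ((norm x)\<^sup>2 - (cmod c)\<^sup>2 * (norm y)\<^sup>2)"
    by (simp only: cinner_norm cc of_real_diff)
  then have "(norm (x - c *\<^sub>C y))\<^sup>2 = (norm x)\<^sup>2 - (cmod c)\<^sup>2 * (norm y)\<^sup>2"
    by (simp only: of_real_eq_iff)
  then have "(cmod c * norm y)\<^sup>2 \<le> (norm x)\<^sup>2"
    by (metis diff_ge_0_iff_ge power_mult_distrib zero_le_power2)
  then have "cmod c * norm y \<le> norm x"
    by (rule power2_le_imp_le) simp
  then have "cmod c * norm y * norm y \<le> norm x * norm y"
    by (rule mult_right_mono) simp
  moreover have "cmod (cinner x y) = cmod c * (norm y)\<^sup>2"
    by (simp add: cy[symmetric] norm_mult norm_power)
  ultimately show ?thesis by (simp add: power2_eq_square mult_ac)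
qed simp

lemma bounded_linear_cinner_left: "bounded_linear (\<lambda>x. cinner x (y :: 'a :: complex_inner))"
  by (rule bounded_linear_intro[where K = "norm y"])
    (simp_all add: cinner_add_left cinner_scaleR_left scaleR_conv_of_real complex_Cauchy_Schwarz)

section \<open>Closure properties of B(H) and rank-one operators\<close>

lemma blinfun_scaleC:
  "T \<in> bounded_operators \<Longrightarrow> blinfun_apply T (a *\<^sub>C x) = a *\<^sub>C blinfun_apply T x"
  by (simp add: bounded_operators_def)

lemma bounded_operators_0: "0 \<in> bounded_operators"
  by (simp add: bounded_operators_def)

lemma bounded_operators_add:
  "S \<in> bounded_operators \<Longrightarrow> T \<in> bounded_operators \<Longrightarrow> S + T \<in> bounded_operators"
  by (simp add: bounded_operators_def blinfun.add_left scaleC_add_right)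

lemma bounded_operators_minus: "S \<in> bounded_operators \<Longrightarrow> - S \<in> bounded_operators"
  by (simp add: bounded_operators_def blinfun.minus_left scaleC_minus_right)

lemma bounded_operators_diff:
  "S \<in> bounded_operators \<Longrightarrow> T \<in> bounded_operators \<Longrightarrow> S - T \<in> bounded_operators"
  using bounded_operators_add[of S "- T"] bounded_operators_minus[of T] by simp

lemma bounded_operators_compose:
  "S \<in> bounded_operators \<Longrightarrow> T \<in> bounded_operators \<Longrightarrow> S o\<^sub>L T \<in> bounded_operators"
  by (simp add: bounded_operators_def)

lemma bounded_operators_scaleR: "T \<in> bounded_operators \<Longrightarrow> r *\<^sub>R T \<in> bounded_operators"
  by (simp add: bounded_operators_def blinfun.scaleR_left scaleC_scaleR)

lemma bounded_operators_id: "id_blinfun \<in> bounded_operators"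
  by (simp add: bounded_operators_def)

lemma scaleC_blinfun_of_real: "scaleC_blinfun (of_real r) T = r *\<^sub>R T"
  by (rule blinfun_eqI) (simp add: scaleC_blinfun.rep_eq scaleC_of_real blinfun.scaleR_left)

text \<open>The operator written \<open>u \<otimes> h\<close> in the overview. The vector
  \<open>h\<close> stands in the conjugate linear slot of \<open>cinner\<close>, so that the
  operator is complex linear.\<close>

lift_definition rank_one :: "'h::chilbert_space \<Rightarrow> 'h \<Rightarrow> 'h \<Rightarrow>\<^sub>L 'h"
  is "\<lambda>u h x. cinner x h *\<^sub>C u"
proof -
  fix u h :: 'h
  show "bounded_linear (\<lambda>x. cinner x h *\<^sub>C u)"
  proof (rule bounded_linear_intro[where K = "norm h * norm u"])
    fix x :: 'h
    have "cmod (cinner x h) * norm u \<le> norm x * norm h * norm u"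
      by (intro mult_right_mono complex_Cauchy_Schwarz) simp
    then show "norm (cinner x h *\<^sub>C u) \<le> norm x * (norm h * norm u)"
      by (simp add: norm_scaleC mult_ac)
  qed (simp_all add: cinner_add_left scaleC_add_left cinner_scaleR_left
        scaleC_scaleC[symmetric] scaleC_of_real)
qed

lemma rank_one_bounded_operators: "rank_one u h \<in> bounded_operators"
  by (simp add: bounded_operators_def rank_one.rep_eq cinner_scaleC_left scaleC_scaleC)

lemma norm_rank_one: "norm (rank_one u h) \<le> norm u * norm h"
proof (rule norm_blinfun_bound)
  fix x
  have "cmod (cinner x h) * norm u \<le> norm x * norm h * norm u"
    by (intro mult_right_mono complex_Cauchy_Schwarz) simp
  then show "norm (rank_one u h x) \<le> norm u * norm h * norm x"
    by (simp add: rank_one.rep_eq norm_scaleC mult_ac)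
qed simp

lemma rank_one_add: "rank_one (u + v) h = rank_one u h + rank_one v h"
  by (rule blinfun_eqI) (simp add: rank_one.rep_eq blinfun.add_left scaleC_add_right)

lemma rank_one_scaleC: "rank_one (a *\<^sub>C u) h = scaleC_blinfun a (rank_one u h)"
  by (rule blinfun_eqI) (simp add: rank_one.rep_eq scaleC_blinfun.rep_eq scaleC_scaleC mult.commute)

text \<open>Combined with the product rule, this identity is what makes a derivation of B(H)
  inner.\<close>

lemma compose_rank_one: "T \<in> bounded_operators \<Longrightarrow> T o\<^sub>L rank_one u h = rank_one (T u) h"
  by (rule blinfun_eqI) (simp add: rank_one.rep_eq blinfun_scaleC)

text \<open>A uniform boundedness principle, by an explicit series instead of Baire category: if
  \<open>V\<close> is unbounded, steps of length 3^-n towards or against vectors of norm above 4^n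
  sum to a vector \<open>h\<close> whose pairings with them grow like (4/3)^n.\<close>

lemma weakly_bounded_imp_bounded:
  fixes V :: "'h::chilbert_space set"
  assumes weak: "\<And>h. \<exists>C. \<forall>v\<in>V. cmod (cinner v h) \<le> C"
  shows "bounded V"
proof (rule ccontr)
  assume "\<not> bounded V"
  then have "\<exists>v\<in>V. norm v > 4 ^ n" for n :: nat
    by (meson bounded_iff not_le)
  then obtain v where vV: "\<And>n. v n \<in> V" and v4: "\<And>n::nat. norm (v n) > 4 ^ n"
    by metis
  define w where "w n = ((1/3) ^ n / norm (v n)) *\<^sub>R v n" for n
  have v0: "norm (v n) > 0" for n
    using v4[of n] by (meson less_trans zero_less_numeral zero_less_power)
  have nw: "norm (w n) = (1/3) ^ n" for n
    using v0[of n] by (simp add: w_def)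
  have vw: "cinner (v n) (w n) = of_real ((1/3) ^ n * norm (v n))" for n
    using v0[of n] by (simp add: w_def cinner_scaleR_right cinner_norm power2_eq_square)
  text \<open>The sign of the \<open>n\<close>th increment makes the pairing of the partial sum with \<open>v n\<close> large, and
    the later increments are too small to spoil this.\<close>
  define step where "step n g = (if cmod (cinner (v n) (g + w n)) \<ge> (1/3) ^ n * norm (v n)
     then g + w n else g - w n)" for n g
  have step_dist: "norm (step n g - g) = (1/3) ^ n" for n g
    by (simp add: step_def nw)
  \<comment> \<open>The pairings of \<open>v n\<close> with the two candidates differ by twice the
    required amount, so if the first falls short the second does not.\<close>
  have step_ge: "cmod (cinner (v n) (step n g)) \<ge> (1/3) ^ n * norm (v n)" for n g
  proof -
    have "2 * ((1/3) ^ n * norm (v n)) = cmod (2 * cinner (v n) (w n))"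
      using v0[of n] by (simp add: vw norm_mult norm_power norm_divide)
    also have "\<dots> = cmod (cinner (v n) (g + w n) - cinner (v n) (g - w n))"
      by (simp add: cinner_add_right cinner_diff_right)
    also have "\<dots> \<le> cmod (cinner (v n) (g + w n)) + cmod (cinner (v n) (g - w n))"
      by (rule norm_triangle_ineq4)
    finally show ?thesis by (auto simp: step_def)
  qed
  define g where "g = rec_nat 0 step"
  have gS: "g (Suc n) = step n (g n)" for n by (simp add: g_def)
  define d where "d n = g (Suc n) - g n" for n
  have nd: "norm (d n) = (1/3) ^ n" for n
    by (simp add: d_def gS step_dist)
  have sm: "summable (\<lambda>n. norm (d n))" by (simp add: nd)
  then have smd: "summable d" by (rule summable_norm_cancel)
  have gsum: "g n = sum d {..<n}" for n
    by (induction n) (simp_all add: d_def g_def)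
  define h where "h = suminf d"
  \<comment> \<open>The steps after the nth sum to at most 3^-(n+1) * 3/2, half the length of the
    nth step; they can destroy at most half of the pairing gained there.\<close>
  have hg: "norm (h - g (Suc n)) \<le> (1/3) ^ n / 2" for n
  proof -
    have "h - g (Suc n) = (\<Sum>k. d (k + Suc n))"
      using suminf_minus_initial_segment[OF smd, of "Suc n"] by (simp add: gsum h_def)
    also have "norm \<dots> \<le> (\<Sum>k. norm (d (k + Suc n)))"
      by (intro summable_norm summable_ignore_initial_segment sm)
    also have "\<dots> = (\<Sum>k. (1/3) ^ Suc n * (1/3) ^ k)"
      by (simp add: nd power_add mult_ac)
    also have "\<dots> = (1/3) ^ Suc n * (\<Sum>k. (1/3) ^ k)"
      by (rule suminf_mult) simp
    also have "\<dots> = (1/3) ^ n / 2"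
      by (simp add: suminf_geometric)
    finally show ?thesis .
  qed
  have big: "cmod (cinner (v n) h) \<ge> (4/3) ^ n / 2" for n
  proof -
    have "(1/3) ^ n * norm (v n) \<le> cmod (cinner (v n) (g (Suc n)))"
      by (simp only: gS step_ge)
    also have "\<dots> = cmod (cinner (v n) h - cinner (v n) (h - g (Suc n)))"
      by (simp add: cinner_diff_right)
    also have "\<dots> \<le> cmod (cinner (v n) h) + cmod (cinner (v n) (h - g (Suc n)))"
      by (rule norm_triangle_ineq4)
    also have "cmod (cinner (v n) (h - g (Suc n))) \<le> norm (v n) * ((1/3) ^ n / 2)"
      by (meson complex_Cauchy_Schwarz hg mult_left_mono norm_ge_zero order_trans)
    finally have "cmod (cinner (v n) h) \<ge> (1/3) ^ n * norm (v n) / 2" by (simp add: mult.commute)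
    moreover have "(1/3) ^ n * norm (v n) \<ge> (1/3) ^ n * 4 ^ n"
      using v4[of n] by (intro mult_left_mono) simp_all
    moreover have "(1/3) ^ n * 4 ^ n = (4/3 :: real) ^ n"
      by (simp add: power_mult_distrib[symmetric])
    ultimately show ?thesis by linarith
  qed
  obtain C where C: "\<forall>x\<in>V. cmod (cinner x h) \<le> C" using weak by blast
  obtain n where "(4/3 :: real) ^ n > 2 * C"
    using real_arch_pow[of "4/3" "2 * C"] by auto
  with big[of n] C vV[of n] show False by fastforce
qed

subsection \<open>Operators that are strongly small but bounded below in norm\<close>

lemma cinner_self_eq_1: "cinner x x = 1 \<Longrightarrow> norm (x :: 'a :: complex_inner) = 1"
proof -
  assume "cinner x x = 1"
  then have "(norm x)\<^sup>2 = 1" by (simp only: cinner_norm of_real_eq_1_iff)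
  then show ?thesis by (simp add: power2_eq_1_iff) (use norm_ge_zero[of x] in linarith)
qed

lemma norm_sum_orthonormal:
  fixes u :: "nat \<Rightarrow> 'h::complex_inner"
  assumes "finite A" and on: "\<And>i j. i \<in> A \<Longrightarrow> j \<in> A \<Longrightarrow> cinner (u i) (u j) = (if i = j then 1 else 0)"
  shows "(norm (\<Sum>i\<in>A. c i *\<^sub>C u i))\<^sup>2 = (\<Sum>i\<in>A. (cmod (c i))\<^sup>2)"
proof -
  have "complex_of_real ((norm (\<Sum>i\<in>A. c i *\<^sub>C u i))\<^sup>2)
      = (\<Sum>i\<in>A. \<Sum>j\<in>A. c i * (cnj (c j) * cinner (u i) (u j)))"
    by (simp only: cinner_norm[symmetric] cinner_sum_left cinner_sum_right cinner_scaleC_left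
        cinner_scaleC_right)
      (subst sum.swap, simp add: sum_distrib_left mult_ac)
  also have "\<dots> = (\<Sum>i\<in>A. \<Sum>j\<in>A. if i = j then c i * cnj (c j) else 0)"
    by (intro sum.cong refl) (simp add: on)
  also have "\<dots> = (\<Sum>i\<in>A. c i * cnj (c i))"
    using \<open>finite A\<close> by simp
  also have "\<dots> = complex_of_real (\<Sum>i\<in>A. (cmod (c i))\<^sup>2)"
    by (simp add: complex_norm_square del: of_real_power)
  finally show ?thesis by (simp only: of_real_eq_iff)
qed

text \<open>The projection \<open>p\<close> of \<open>v\<close> on the span satisfies <v, p> =
  |p|^2, and Cauchy-Schwarz then gives |p| \<le> |v|.\<close>

lemma Bessel_inequality:
  fixes u :: "nat \<Rightarrow> 'h::complex_inner"
  assumes "finite A" and on: "\<And>i j. i \<in> A \<Longrightarrow> j \<in> A \<Longrightarrow> cinner (u i) (u j) = (if i = j then 1 else 0)"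
  shows "(\<Sum>i\<in>A. (cmod (cinner v (u i)))\<^sup>2) \<le> (norm v)\<^sup>2"
proof -
  define S where "S = (\<Sum>i\<in>A. (cmod (cinner v (u i)))\<^sup>2)"
  define p where "p = (\<Sum>i\<in>A. cinner v (u i) *\<^sub>C u i)"
  have S0: "S \<ge> 0" unfolding S_def by (intro sum_nonneg) simp
  have np: "(norm p)\<^sup>2 = S"
    unfolding p_def S_def by (rule norm_sum_orthonormal[OF assms])
  have "cinner v p = (\<Sum>i\<in>A. cnj (cinner v (u i)) * cinner v (u i))"
    by (simp add: p_def cinner_sum_right cinner_scaleC_right)
  also have "\<dots> = of_real S"
    by (simp add: S_def complex_norm_square mult.commute del: of_real_power)
  finally have "S = cmod (cinner v p)" using S0 by simp
  also have "\<dots> \<le> norm v * norm p" by (rule complex_Cauchy_Schwarz)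
  finally have "(norm p)\<^sup>2 \<le> norm v * norm p" by (simp only: np)
  then have "norm p \<le> norm v" by (cases "norm p = 0") (auto simp: power2_eq_square)
  then have "(norm p)\<^sup>2 \<le> (norm v)\<^sup>2" by (intro power_mono) auto
  then show ?thesis by (simp add: np S_def)
qed

text \<open>The operator is the sum of <v, u (n+1)> u n over all n, the backward shift on the closed
  span of the \<open>u n\<close>. It vanishes on the orthogonal complement, so the
  \<open>u n\<close> need not form a basis.\<close>

lemma ex_shift_operator:
  fixes u :: "nat \<Rightarrow> 'h::chilbert_space"
  assumes on: "\<And>i j. cinner (u i) (u j) = (if i = j then 1 else 0)"
  shows "\<exists>T \<in> bounded_operators. norm T \<le> 1 \<and>
    (\<forall>v n. cinner (blinfun_apply T v) (u n) = cinner v (u (Suc n)))"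
proof -
  define t where "t v n = cinner v (u (Suc n)) *\<^sub>C u n" for v n
  have norm_t: "(norm (\<Sum>i\<in>A. t v i))\<^sup>2 = (\<Sum>i\<in>A. (cmod (cinner v (u (Suc i))))\<^sup>2)"
    if "finite A" for A v
    unfolding t_def by (rule norm_sum_orthonormal[OF that on])
  have bessel: "(\<Sum>i\<in>A. (cmod (cinner v (u (Suc i))))\<^sup>2) \<le> (norm v)\<^sup>2" if "finite A" for A v
    by (rule Bessel_inequality[OF that]) (simp add: on)
  have sq: "summable (\<lambda>n. (cmod (cinner v (u (Suc n))))\<^sup>2)" for v
    by (rule summableI_nonneg_bounded[where x = "(norm v)\<^sup>2"]) (simp_all add: bessel)
  \<comment> \<open>By orthonormality the squared norm of a block of terms is a block of the
    convergent real series \<open>sq\<close>, so the Cauchy criterion carries over.\<close>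
  have sm: "summable (t v)" for v
    unfolding summable_Cauchy
  proof (intro allI impI)
    fix e :: real assume "e > 0"
    then have "e\<^sup>2 > 0" by simp
    with sq[of v] obtain N where
      N: "\<forall>m\<ge>N. \<forall>n. norm (\<Sum>k\<in>{m..<n}. (cmod (cinner v (u (Suc k))))\<^sup>2) < e\<^sup>2"
      unfolding summable_Cauchy by blast
    have "norm (\<Sum>k\<in>{m..<n}. t v k) < e" if "m \<ge> N" for m n
    proof -
      have "(norm (\<Sum>k\<in>{m..<n}. t v k))\<^sup>2 < e\<^sup>2"
        using N that by (auto simp: norm_t sum_nonneg)
      then show ?thesis using \<open>e > 0\<close> by (simp add: power2_less_imp_less)
    qed
    then show "\<exists>N. \<forall>m\<ge>N. \<forall>n. norm (sum (t v) {m..<n}) < e" by blast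
  qed
  define f where "f v = suminf (t v)" for v
  have lim: "(\<lambda>n. \<Sum>k<n. t v k) \<longlonglongrightarrow> f v" for v
    unfolding f_def using sm by (rule summable_LIMSEQ)
  have nf: "norm (f v) \<le> norm v" for v
  proof (rule LIMSEQ_le_const2[OF tendsto_norm[OF lim]], intro exI allI impI)
    fix n
    have "(norm (\<Sum>k<n. t v k))\<^sup>2 \<le> (norm v)\<^sup>2" by (simp add: norm_t bessel)
    then show "norm (\<Sum>k<n. t v k) \<le> norm v" by (rule power2_le_imp_le) simp
  qed
  have scale: "f (a *\<^sub>C v) = a *\<^sub>C f v" for a v
  proof (rule LIMSEQ_unique[OF lim])
    have bl: "bounded_linear (\<lambda>y::'h. a *\<^sub>C y)"
      by (rule bounded_linear_intro[where K = "cmod a"])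
        (simp_all add: scaleC_add_right scaleC_scaleR norm_scaleC)
    have "(\<Sum>k<n. t (a *\<^sub>C v) k) = a *\<^sub>C (\<Sum>k<n. t v k)" for n
      by (induction n) (simp_all add: t_def scaleC_add_right scaleC_scaleC cinner_scaleC_left)
    then show "(\<lambda>n. \<Sum>k<n. t (a *\<^sub>C v) k) \<longlonglongrightarrow> a *\<^sub>C f v"
      using bounded_linear.tendsto[OF bl lim[of v]] by simp
  qed
  have add: "f (v + w) = f v + f w" for v w
  proof (rule LIMSEQ_unique[OF lim])
    have "(\<Sum>k<n. t (v + w) k) = (\<Sum>k<n. t v k) + (\<Sum>k<n. t w k)" for n
      by (simp add: t_def sum.distrib cinner_add_left scaleC_add_left)
    then show "(\<lambda>n. \<Sum>k<n. t (v + w) k) \<longlonglongrightarrow> f v + f w"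
      using tendsto_add[OF lim lim] by simp
  qed
  have bl: "bounded_linear f"
    by (rule bounded_linear_intro[where K = 1])
      (simp_all add: add scale nf scaleC_of_real[symmetric])
  have inner: "cinner (f v) (u n) = cinner v (u (Suc n))" for v n
  proof -
    have "(\<lambda>k. cinner (t v k) (u n)) sums cinner (f v) (u n)"
      unfolding f_def by (rule bounded_linear.sums[OF bounded_linear_cinner_left summable_sums[OF sm]])
    moreover have "(\<lambda>k. cinner (t v k) (u n)) = (\<lambda>k. if k = n then cinner v (u (Suc k)) else 0)"
      by (auto simp: t_def cinner_scaleC_left on)
    ultimately show ?thesis
      using sums_single[of n "\<lambda>k. cinner v (u (Suc k))"] sums_unique2 by fastforce
  qed
  show ?thesis
  proof (intro bexI conjI allI)
    show "norm (Blinfun f) \<le> 1"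
      by (rule norm_blinfun_bound) (simp_all add: bounded_linear_Blinfun_apply[OF bl] nf)
    show "Blinfun f \<in> bounded_operators"
      by (simp add: bounded_operators_def bounded_linear_Blinfun_apply[OF bl] scale)
    show "cinner (Blinfun f v) (u n) = cinner v (u (Suc n))" for v n
      by (simp add: bounded_linear_Blinfun_apply[OF bl] inner)
  qed
qed

text \<open>Along a sequence of operators of norm bounded below that become arbitrarily small, together
  with their adjoints, on any finite set of vectors, one chooses orthonormal vectors
  \<open>u\<^sub>n\<close> in the directions of large values \<open>Y\<^sub>n x\<^sub>n\<close>. The shift \<open>T\<close> along the
  \<open>u\<^sub>n\<close> then keeps the commutators uniformly apart, because
  \<open>\<langle>(Y T - T Y) x\<^sub>n, u\<^sub>n\<^sub>-\<^sub>1\<rangle> = \<langle>T x\<^sub>n, Y* u\<^sub>n\<^sub>-\<^sub>1\<rangle> - \<langle>Y x\<^sub>n, u\<^sub>n\<rangle>\<close>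
  has a small first term, while the second one is large for \<open>Y = Y\<^sub>n\<close> and small for
  \<open>Y = Y\<^sub>m\<close> with \<open>m > n\<close>.\<close>

lemma gliding_hump:
  fixes S :: "('h::chilbert_space \<Rightarrow>\<^sub>L 'h) set"
  assumes "\<epsilon> > 0"
    and small: "\<And>V \<delta>. finite V \<Longrightarrow> \<delta> > 0 \<Longrightarrow> \<exists>Y\<in>S. norm Y > \<epsilon> \<and>
      (\<forall>v\<in>V. norm (blinfun_apply Y v) \<le> \<delta> \<and> (\<forall>x. cmod (cinner (blinfun_apply Y x) v) \<le> \<delta> * norm x))"
  obtains T Y where "T \<in> bounded_operators" "\<And>n::nat. Y n \<in> S"
    "\<And>n m. n < m \<Longrightarrow> norm (((Y n o\<^sub>L T) - (T o\<^sub>L Y n)) - ((Y m o\<^sub>L T) - (T o\<^sub>L Y m))) \<ge> \<epsilon> / 2"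
proof -
  \<comment> \<open>Admissibility of the next triple \<open>(Y, x, u)\<close>, where
    \<open>p\<close> is the set of earlier pairs \<open>(x', u')\<close>.\<close>
  define ok where "ok p Y x u \<longleftrightarrow> Y \<in> S \<and> norm x = 1 \<and> cinner u u = 1 \<and>
      cmod (cinner (blinfun_apply Y x) u) \<ge> 3 / 4 * \<epsilon> \<and>
      (\<forall>(x', u')\<in>p. cinner u u' = 0 \<and> norm (blinfun_apply Y x') \<le> \<epsilon> / 16 \<and>
        (\<forall>z. cmod (cinner (blinfun_apply Y z) u') \<le> \<epsilon> / 16 * norm z))"
    for p :: "('h \<times> 'h) set" and Y x u
  define P where "P f n r \<longleftrightarrow>
      ok ((\<lambda>k. snd (f k)) ` {..<n}) (fst r) (fst (snd r)) (snd (snd r))"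
    for f :: "nat \<Rightarrow> ('h \<Rightarrow>\<^sub>L 'h) \<times> 'h \<times> 'h" and n r
  \<comment> \<open>Each choice must respect all earlier ones, hence choice along a well-founded
    relation. The first obligation says that \<open>P f n\<close> looks at \<open>f\<close> only
    below \<open>n\<close>.\<close>
  have "\<exists>f. \<forall>n. P f n (f n)"
  proof (rule dependent_wf_choice[OF wf_less])
    fix f g :: "nat \<Rightarrow> ('h \<Rightarrow>\<^sub>L 'h) \<times> 'h \<times> 'h" and n r
    assume "\<And>z. (z, n) \<in> {(x, y). x < y} \<Longrightarrow> f z = g z"
    then show "P f n r = P g n r" by (simp add: P_def cong: image_cong_simp)
  next
    fix n and f :: "nat \<Rightarrow> ('h \<Rightarrow>\<^sub>L 'h) \<times> 'h \<times> 'h"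
    assume prev: "\<And>y. (y, n) \<in> {(x, y). x < y} \<Longrightarrow> P f y (f y)"
    define xx where "xx k = fst (snd (f k))" for k
    define uu where "uu k = snd (snd (f k))" for k
    have uu1: "cinner (uu k) (uu k) = 1" if "k < n" for k
      using prev[of k] that by (simp add: P_def ok_def uu_def)
    have uu0': "cinner (uu k) (uu j) = 0" if "k < n" "j < k" for k j
      using prev[of k] that by (simp add: P_def ok_def uu_def case_prod_beta)
    have uu0: "cinner (uu k) (uu j) = 0" if "k < n" "j < n" "k \<noteq> j" for k j
      using that uu0'[of k j] uu0'[of j k]
      by (metis cinner_commute complex_cnj_zero nat_neq_iff)
    \<comment> \<open>Divided by n + 1 so that the \<open>n\<close> components along the earlier
      \<open>uu k\<close> together still cost at most \<epsilon>/16.\<close>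
    define \<delta> where "\<delta> = \<epsilon> / (16 * (real n + 1))"
    have \<delta>: "\<delta> > 0" "\<delta> \<le> \<epsilon> / 16" "real n * \<delta> \<le> \<epsilon> / 16"
      using \<open>\<epsilon> > 0\<close> by (auto simp: \<delta>_def field_simps)
    obtain Y where "Y \<in> S" and nY: "norm Y > \<epsilon>"
      and Yv: "\<And>v. v \<in> xx ` {..<n} \<union> uu ` {..<n} \<Longrightarrow> norm (Y v) \<le> \<delta>"
      and Ya: "\<And>v x. v \<in> xx ` {..<n} \<union> uu ` {..<n} \<Longrightarrow> cmod (cinner (Y x) v) \<le> \<delta> * norm x"
      using small[of "xx ` {..<n} \<union> uu ` {..<n}" \<delta>] \<delta> by auto
    obtain x0 where x0: "norm (Y x0) > \<epsilon> * norm x0"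
      using norm_blinfun_bound[of \<epsilon> Y] nY \<open>\<epsilon> > 0\<close> by (meson less_imp_le not_le)
    then have "x0 \<noteq> 0" by auto
    define x where "x = (1 / norm x0) *\<^sub>R x0"
    have nx: "norm x = 1" using \<open>x0 \<noteq> 0\<close> by (simp add: x_def)
    have Yx: "norm (Y x) > \<epsilon>"
      using x0 \<open>x0 \<noteq> 0\<close> by (simp add: x_def blinfun.scaleR_right field_simps)
    \<comment> \<open>A Gram-Schmidt step: the part of \<open>Y x\<close> orthogonal to all earlier
      \<open>uu k\<close>. Its norm is at least \<epsilon> - \<epsilon>/16, and it equals the
      pairing of \<open>Y x\<close> with the normalized vector \<open>u\<close>.\<close>
    define w where "w = Y x - (\<Sum>k<n. cinner (Y x) (uu k) *\<^sub>C uu k)"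
    have wu: "cinner w (uu k) = 0" if "k < n" for k
    proof -
      have "(\<Sum>j<n. cinner (Y x) (uu j) * cinner (uu j) (uu k))
          = (\<Sum>j<n. if j = k then cinner (Y x) (uu j) else 0)"
        using that by (intro sum.cong) (auto simp: uu0 uu1)
      then show ?thesis
        using that by (simp add: w_def cinner_diff_left cinner_sum_left cinner_scaleC_left)
    qed
    have "norm (\<Sum>k<n. cinner (Y x) (uu k) *\<^sub>C uu k) \<le> real n * \<delta>"
    proof -
      have "norm (cinner (Y x) (uu k) *\<^sub>C uu k) \<le> \<delta>" if "k < n" for k
      proof -
        have "norm (uu k) = 1"
          using uu1[OF that] by (rule cinner_self_eq_1)
        then show ?thesis using Ya[of "uu k" x] that by (auto simp: norm_scaleC nx)
      qed
      then show ?thesis using sum_norm_bound[of "{..<n}" "\<lambda>k. cinner (Y x) (uu k) *\<^sub>C uu k" \<delta>] by simp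
    qed
    moreover have "norm (Y x) \<le> norm w + norm (\<Sum>k<n. cinner (Y x) (uu k) *\<^sub>C uu k)"
      unfolding w_def by (metis add.commute norm_triangle_sub)
    ultimately have nw: "norm w \<ge> 3 / 4 * \<epsilon>" using Yx \<delta> \<open>\<epsilon> > 0\<close> by linarith
    then have w0: "norm w > 0" using \<open>\<epsilon> > 0\<close> by linarith
    define u where "u = (1 / norm w) *\<^sub>R w"
    have "cinner (Y x) w = cinner w w + (\<Sum>k<n. cinner (Y x) (uu k) * cinner (uu k) w)"
    proof -
      have "cinner (Y x) w = cinner (w + (\<Sum>k<n. cinner (Y x) (uu k) *\<^sub>C uu k)) w"
        by (simp add: w_def)
      then show ?thesis by (simp add: cinner_add_left cinner_sum_left cinner_scaleC_left)
    qed
    also have "\<dots> = cinner w w"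
      using wu by (simp add: sum.neutral) (metis (no_types, lifting) cinner_commute complex_cnj_zero lessThan_iff mult_zero_right sum.neutral)
    finally have "cmod (cinner (Y x) u) = norm w"
      using w0 by (simp add: u_def cinner_scaleR_right cinner_norm norm_mult norm_divide norm_power
          power2_eq_square)
    moreover have "cinner u u = 1"
      using w0 by (simp add: cinner_norm u_def)
    moreover have "cinner u (uu k) = 0" if "k < n" for k
      using wu[OF that] by (simp add: u_def cinner_scaleR_left)
    moreover have "norm (Y (xx k)) \<le> \<epsilon> / 16" if "k < n" for k
      using Yv[of "xx k"] that \<delta> by auto
    moreover have "cmod (cinner (Y z) (uu k)) \<le> \<epsilon> / 16 * norm z" if "k < n" for k z
    proof -
      have "cmod (cinner (Y z) (uu k)) \<le> \<delta> * norm z" using Ya that by auto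
      also have "\<dots> \<le> \<epsilon> / 16 * norm z" using \<delta> by (intro mult_right_mono) auto
      finally show ?thesis .
    qed
    ultimately have "P f n (Y, x, u)"
      using \<open>Y \<in> S\<close> nx nw by (simp add: P_def ok_def xx_def uu_def case_prod_beta)
    then show "\<exists>r. P f n r" ..
  qed
  then obtain f where f: "\<And>n. P f n (f n)" by blast
  define Y where "Y k = fst (f k)" for k
  define x where "x k = fst (snd (f k))" for k
  define u where "u k = snd (snd (f k))" for k
  have fP: "Y n \<in> S \<and> norm (x n) = 1 \<and> cinner (u n) (u n) = 1 \<and>
      cmod (cinner (Y n (x n)) (u n)) \<ge> 3 / 4 * \<epsilon> \<and>
      (\<forall>k<n. cinner (u n) (u k) = 0 \<and> norm (Y n (x k)) \<le> \<epsilon> / 16 \<and>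
        (\<forall>z. cmod (cinner (Y n z) (u k)) \<le> \<epsilon> / 16 * norm z))" for n
    using f[of n] by (simp add: P_def ok_def Y_def x_def u_def case_prod_beta)
  have u0: "cinner (u k) (u j) = 0" if "k \<noteq> j" for k j
    using that fP[of k] fP[of j] by (metis cinner_commute complex_cnj_zero nat_neq_iff)
  then have "cinner (u i) (u j) = (if i = j then 1 else 0)" for i j
    using fP[of i] by auto
  then obtain T where T: "T \<in> bounded_operators" "norm T \<le> 1"
    "\<And>v n. cinner (blinfun_apply T v) (u n) = cinner v (u (Suc n))"
    using ex_shift_operator by metis
  \<comment> \<open>The commutators are evaluated at \<open>x (Suc n)\<close> and paired with
    \<open>u n\<close>, since \<open>T\<close> lowers the index by one. The sequence therefore
    starts with \<open>Y 1\<close>.\<close>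
  show thesis
  proof (rule that[of T "\<lambda>n. Y (Suc n)"])
    fix n m :: nat assume nm: "n < m"
    define A where "A = ((Y (Suc n) o\<^sub>L T) - (T o\<^sub>L Y (Suc n))) - ((Y (Suc m) o\<^sub>L T) - (T o\<^sub>L Y (Suc m)))"
    define z where "z = blinfun_apply T (x (Suc n))"
    have x1: "norm (x k) = 1" for k using fP[of k] by simp
    have u1: "norm (u k) = 1" for k using fP[of k] by (simp add: cinner_self_eq_1)
    have nz: "norm z \<le> 1"
      using norm_blinfun[of T "x (Suc n)"] T(2) by (simp add: z_def x1)
    have zb: "cmod (cinner (Y k z) (u n)) \<le> \<epsilon> / 16" if "n < k" for k
    proof -
      have "cmod (cinner (Y k z) (u n)) \<le> \<epsilon> / 16 * norm z" using fP[of k] that by simp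
      also have "\<dots> \<le> \<epsilon> / 16 * 1" using nz \<open>\<epsilon> > 0\<close> by (intro mult_left_mono) auto
      finally show ?thesis by simp
    qed
    have Ym: "cmod (cinner (Y (Suc m) (x (Suc n))) (u (Suc n))) \<le> \<epsilon> / 16"
    proof -
      have "norm (Y (Suc m) (x (Suc n))) \<le> \<epsilon> / 16" using fP[of "Suc m"] nm by simp
      then show ?thesis
        using complex_Cauchy_Schwarz[of "Y (Suc m) (x (Suc n))" "u (Suc n)"] by (simp add: u1)
    qed
    have Yn: "cmod (cinner (Y (Suc n) (x (Suc n))) (u (Suc n))) \<ge> 3 / 4 * \<epsilon>"
      using fP[of "Suc n"] by simp
    have tri: "cmod b \<le> cmod p + cmod a + cmod c + cmod d" if "p = a - b - (c - d)" for p a b c d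
    proof -
      have "b = (a - p) - (c - d)" using that by simp
      then show ?thesis
        using norm_triangle_ineq4[of "a - p" "c - d"] norm_triangle_ineq4[of a p]
          norm_triangle_ineq4[of c d] by simp
    qed
    have "cinner (A (x (Suc n))) (u n)
        = cinner (Y (Suc n) z) (u n) - cinner (Y (Suc n) (x (Suc n))) (u (Suc n))
          - (cinner (Y (Suc m) z) (u n) - cinner (Y (Suc m) (x (Suc n))) (u (Suc n)))"
      by (simp add: A_def z_def blinfun.diff_left cinner_diff_left T(3))
    then have "cmod (cinner (Y (Suc n) (x (Suc n))) (u (Suc n)))
        \<le> cmod (cinner (A (x (Suc n))) (u n)) + cmod (cinner (Y (Suc n) z) (u n))
          + cmod (cinner (Y (Suc m) z) (u n)) + cmod (cinner (Y (Suc m) (x (Suc n))) (u (Suc n)))"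
      by (rule tri)
    moreover have "cmod (cinner (A (x (Suc n))) (u n)) \<le> norm A"
    proof -
      have "cmod (cinner (A (x (Suc n))) (u n)) \<le> norm (A (x (Suc n)))"
        using complex_Cauchy_Schwarz[of "A (x (Suc n))" "u n"] by (simp add: u1)
      then show ?thesis using norm_blinfun[of A "x (Suc n)"] by (simp add: x1)
    qed
    \<comment> \<open>Three errors of at most \<epsilon>/16 are taken from 3\<epsilon>/4, which
      leaves 9\<epsilon>/16.\<close>
    ultimately have "norm A \<ge> \<epsilon> / 2"
      using zb[of "Suc n"] zb[of "Suc m"] nm Ym Yn \<open>\<epsilon> > 0\<close> by simp
    then show "norm (((Y (Suc n) o\<^sub>L T) - (T o\<^sub>L Y (Suc n))) - ((Y (Suc m) o\<^sub>L T) - (T o\<^sub>L Y (Suc m)))) \<ge> \<epsilon> / 2"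
      by (simp add: A_def)
  qed (use T fP in simp_all)
qed

subsection \<open>Functions vanishing at infinity\<close>

text \<open>The conditions of \<open>C_0\<close> other than membership in
  \<open>bounded_operators\<close>, for values in any real normed space, so that real bump functions
  are covered too.\<close>

definition vanishing_map :: "'l topology \<Rightarrow> ('l \<Rightarrow> 'a::real_normed_vector) \<Rightarrow> bool" where
  "vanishing_map L f \<longleftrightarrow> continuous_map L euclidean f \<and>
     (\<forall>e>0. \<exists>K. compactin L K \<and> (\<forall>t \<in> topspace L - K. norm (f t) < e)) \<and>
     (\<forall>t. t \<notin> topspace L \<longrightarrow> f t = 0)"

lemma C_0_iff: "X \<in> C_0 L \<longleftrightarrow> vanishing_map L X \<and> X ` topspace L \<subseteq> bounded_operators"
  by (auto simp: C_0_def vanishing_map_def)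

text \<open>Decay survives because \<phi> is continuous at 0 and vanishes there. Multiples and
  squares of bumps and the factors of an element of \<open>C_0\<close> all arise in this
  way.\<close>

lemma vanishing_map_compose:
  assumes f: "vanishing_map L f" and \<phi>: "continuous_on UNIV \<phi>" "\<phi> 0 = 0"
  shows "vanishing_map L (\<lambda>t. \<phi> (f t))"
  unfolding vanishing_map_def
proof (intro conjI allI impI)
  show "continuous_map L euclidean (\<lambda>t. \<phi> (f t))"
    using continuous_map_compose[of L euclidean f euclidean \<phi>] f \<phi>
    by (simp add: vanishing_map_def o_def)
next
  fix e :: real assume "e > 0"
  moreover have "isCont \<phi> 0" using \<phi> by (simp add: continuous_on_eq_continuous_at)
  ultimately obtain d where "d > 0" and d: "\<And>x. norm x < d \<Longrightarrow> norm (\<phi> x) < e"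
    using \<phi>(2) unfolding continuous_at_eps_delta by (auto simp: dist_norm)
  obtain K where "compactin L K" "\<forall>t \<in> topspace L - K. norm (f t) < d"
    using f \<open>d > 0\<close> unfolding vanishing_map_def by blast
  then show "\<exists>K. compactin L K \<and> (\<forall>t \<in> topspace L - K. norm (\<phi> (f t)) < e)"
    using d by blast
qed (use assms in \<open>simp add: vanishing_map_def\<close>)

lemma vanishing_map_add:
  assumes "vanishing_map L f" "vanishing_map L g"
  shows "vanishing_map L (\<lambda>t. f t + g t)"
  unfolding vanishing_map_def
proof (intro conjI allI impI)
  show "continuous_map L euclidean (\<lambda>t. f t + g t)"
    using assms by (intro continuous_map_add) (auto simp: vanishing_map_def)
next
  fix e :: real assume "e > 0"
  then have "e / 2 > 0" by simp
  then obtain K K' where K: "compactin L K" "\<forall>t \<in> topspace L - K. norm (f t) < e / 2"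
    and K': "compactin L K'" "\<forall>t \<in> topspace L - K'. norm (g t) < e / 2"
    using assms unfolding vanishing_map_def by metis
  have "norm (f t + g t) < e" if "t \<in> topspace L - (K \<union> K')" for t
  proof -
    have "norm (f t) < e / 2" "norm (g t) < e / 2" using K K' that by auto
    then show ?thesis using norm_triangle_ineq[of "f t" "g t"] by linarith
  qed
  then show "\<exists>K. compactin L K \<and> (\<forall>t \<in> topspace L - K. norm (f t + g t) < e)"
    using compactin_Un[OF K(1) K'(1)] by blast
qed (use assms in \<open>simp add: vanishing_map_def\<close>)

lemma vanishing_map_diff:
  assumes "vanishing_map L f" "vanishing_map L g"
  shows "vanishing_map L (\<lambda>t. f t - g t)"
  using vanishing_map_add[OF assms(1) vanishing_map_compose[OF assms(2), of uminus]]
  by (simp add: continuous_on_minus)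

lemma vanishing_map_0: "vanishing_map L (\<lambda>t. 0)"
  unfolding vanishing_map_def by (auto intro: exI[of _ "{}"])

lemma vanishing_map_sum:
  fixes f :: "nat \<Rightarrow> 'l \<Rightarrow> 'a::real_normed_vector"
  assumes "\<And>i. vanishing_map L (f i)"
  shows "vanishing_map L (\<lambda>t. \<Sum>i<n. f i t)"
  using assms by (induction n) (simp_all add: vanishing_map_0 vanishing_map_add)

lemma vanishing_map_bounded:
  assumes "vanishing_map L f"
  shows "bounded (f ` topspace L)"
proof -
  obtain K where K: "compactin L K" "\<forall>t \<in> topspace L - K. norm (f t) < 1"
    using assms unfolding vanishing_map_def by (meson zero_less_one)
  have "compact (f ` K)"
    using image_compactin[OF K(1), of euclidean f] assms by (simp add: vanishing_map_def)
  then have "bounded (f ` K)" by (rule compact_imp_bounded)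
  moreover have "bounded (f ` (topspace L - K))"
    using K(2) by (intro boundedI[where B = 1]) (auto intro: less_imp_le)
  ultimately have "bounded (f ` K \<union> f ` (topspace L - K))" by simp
  then show ?thesis by (rule bounded_subset) auto
qed

text \<open>Serves to sum an infinite series of bumps. The compact set for the limit is taken from a
  single \<open>F n\<close> within e/2 of it.\<close>

lemma vanishing_map_uniform_limit:
  fixes F :: "nat \<Rightarrow> 'l \<Rightarrow> 'a::real_normed_vector"
  assumes F: "\<And>n. vanishing_map L (F n)" and lim: "uniform_limit UNIV F g sequentially"
  shows "vanishing_map L g"
  unfolding vanishing_map_def
proof (intro conjI allI impI)
  have "continuous_map L Met_TC.mtopology g"
  proof (rule Met_TC.continuous_map_uniform_limit[where F = sequentially and f = F])
    show "\<forall>\<^sub>F n in sequentially. continuous_map L Met_TC.mtopology (F n)"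
      using F by (simp add: vanishing_map_def)
    show "\<forall>\<^sub>F n in sequentially. \<forall>x\<in>topspace L. g x \<in> UNIV \<and> dist (F n x) (g x) < \<epsilon>"
      if "\<epsilon> > 0" for \<epsilon>
      using uniform_limitD[OF lim that] by (auto elim: eventually_mono)
  qed simp
  then show "continuous_map L euclidean g" by simp
next
  fix e :: real assume "e > 0"
  then obtain n where n: "\<And>t. dist (F n t) (g t) < e / 2"
    using uniform_limitD[OF lim, of "e / 2"] eventually_happens'[OF sequentially_bot] by force
  obtain K where K: "compactin L K" "\<forall>t \<in> topspace L - K. norm (F n t) < e / 2"
    using F[of n] \<open>e > 0\<close> unfolding vanishing_map_def by (meson half_gt_zero)
  have "norm (g t) < e" if "t \<in> topspace L - K" for t
  proof -
    have "norm (F n t) < e / 2" using K that by blast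
    then show ?thesis using n[of t] norm_triangle_ineq4[of "F n t" "F n t - g t"]
      by (simp add: dist_norm)
  qed
  then show "\<exists>K. compactin L K \<and> (\<forall>t \<in> topspace L - K. norm (g t) < e)"
    using K(1) by blast
next
  fix t assume "t \<notin> topspace L"
  then have "(\<lambda>n. F n t) = (\<lambda>n. 0)" using F by (simp add: vanishing_map_def)
  then show "g t = 0"
    using tendsto_uniform_limitI[OF lim, of t] by (simp add: LIMSEQ_const_iff)
qed

text \<open>Complete regularity gives a function with value 2 at \<open>t\<close> and 0 off a
  neighbourhood contained in a compact set. Truncation at height 1 produces a plateau on the open
  set where the function exceeds 1.\<close>

lemma ex_bump:
  assumes "locally_compact_space L" "Hausdorff_space L" "t \<in> topspace L"
  obtains f :: "'l \<Rightarrow> real" and U where "vanishing_map L f" "openin L U" "t \<in> U"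
    "\<And>s. s \<in> U \<Longrightarrow> f s = 1" "\<And>s. 0 \<le> f s" "\<And>s. f s \<le> 1"
proof -
  obtain V K where V: "openin L V" "compactin L K" "t \<in> V" "V \<subseteq> K"
    using assms unfolding locally_compact_space_def by blast
  have "completely_regular_space L"
    using assms locally_compact_regular_imp_completely_regular_space by blast
  then have "\<forall>S x. openin L S \<longrightarrow> x \<in> S \<longrightarrow>
      (\<exists>g. continuous_map L euclideanreal g \<and> g x = 2 \<and> g ` (topspace L - S) \<subseteq> {0})"
    using completely_regular_space_gen_alt'[of "2::real" 0 L] by simp
  then obtain g :: "'l \<Rightarrow> real" where g: "continuous_map L euclidean g" "g t = 2"
    "g ` (topspace L - V) \<subseteq> {0}"
    using V(1,3) by blast
  define h where "h s = max 0 (min (g s) 1)" for s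
  define f where "f s = (if s \<in> topspace L then h s else 0)" for s
  define U where "U = {s \<in> topspace L. g s \<in> {1<..}}"
  have "continuous_map L euclidean h"
    unfolding h_def using g by (intro continuous_map_real_max continuous_map_real_min) auto
  then have cf: "continuous_map L euclidean f"
    by (rule continuous_map_eq) (simp add: f_def)
  have "f s = 0" if "s \<in> topspace L - K" for s
  proof -
    have "g s = 0" using g(3) that V(4) by blast
    then show ?thesis by (simp add: f_def h_def)
  qed
  then have "vanishing_map L f"
    unfolding vanishing_map_def using cf V(2) by (auto simp: f_def intro!: exI[of _ K])
  moreover have "openin L U"
    unfolding U_def using g(1) by (rule openin_continuous_map_preimage) simp
  ultimately show thesis
    using assms(3) g(2) by (intro that[of f U]) (auto simp: U_def f_def h_def)
qed

section \<open>Elements of \<open>C_0\<close>, their factorization, and the supremum norm\<close>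

lemma C_0_scaleR:
  "vanishing_map L f \<Longrightarrow> T \<in> bounded_operators \<Longrightarrow> (\<lambda>t. f t *\<^sub>R T) \<in> C_0 L"
  using vanishing_map_compose[of L f "\<lambda>r. r *\<^sub>R T"]
  by (auto simp: C_0_iff bounded_operators_scaleR continuous_on_scaleR)

lemma C_0_diff: "X \<in> C_0 L \<Longrightarrow> Y \<in> C_0 L \<Longrightarrow> (\<lambda>t. X t - Y t) \<in> C_0 L"
  unfolding C_0_iff by (auto intro!: vanishing_map_diff bounded_operators_diff)

lemma C_0_bounded_operators: "X \<in> C_0 L \<Longrightarrow> X t \<in> bounded_operators"
  unfolding C_0_iff vanishing_map_def by (cases "t \<in> topspace L") (auto simp: bounded_operators_0)

text \<open>Write W as W / sqrt |W| times sqrt |W| times the identity. Both factors are continuous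
  functions of the value of \<open>W\<close> that vanish at 0.\<close>

lemma C_0_factorization:
  assumes W: "W \<in> C_0 L"
  shows "\<exists>A\<in>C_0 L. \<exists>B\<in>C_0 L. W = (\<lambda>t. A t o\<^sub>L B t) \<and> (\<forall>t. W t = 0 \<longrightarrow> A t = 0 \<and> B t = 0)"
proof -
  define \<alpha> where "\<alpha> T = (1 / sqrt (norm T)) *\<^sub>R T" for T :: "'b \<Rightarrow>\<^sub>L 'b"
  define \<beta> where "\<beta> T = sqrt (norm T) *\<^sub>R (id_blinfun :: 'b \<Rightarrow>\<^sub>L 'b)" for T :: "'b \<Rightarrow>\<^sub>L 'b"
  have "isCont \<alpha> T" for T
  proof (cases "T = 0")
    case True
    \<comment> \<open>Continuity at 0 is the delicate point; this formula settles it and holds for S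
      = 0 as well, both sides being 0.\<close>
    have "norm (\<alpha> S) = sqrt (norm S)" for S
      by (simp add: \<alpha>_def real_div_sqrt)
    then have "(\<lambda>S. norm (\<alpha> S)) \<midarrow>0\<rightarrow> 0"
      by (auto intro!: tendsto_eq_intros)
    then show ?thesis
      unfolding True isCont_def by (metis \<alpha>_def scaleR_zero_right tendsto_norm_zero_cancel)
  next
    case False
    then show ?thesis unfolding \<alpha>_def by (intro continuous_intros) auto
  qed
  then have "continuous_on UNIV \<alpha>" by (simp add: continuous_at_imp_continuous_on)
  moreover have "continuous_on UNIV \<beta>" unfolding \<beta>_def by (intro continuous_intros)
  moreover have "vanishing_map L W" using W by (simp add: C_0_iff)
  ultimately have "vanishing_map L (\<lambda>t. \<alpha> (W t))" "vanishing_map L (\<lambda>t. \<beta> (W t))"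
    using vanishing_map_compose[of L W \<alpha>] vanishing_map_compose[of L W \<beta>]
    by (simp_all add: \<alpha>_def \<beta>_def)
  then have "(\<lambda>t. \<alpha> (W t)) \<in> C_0 L" "(\<lambda>t. \<beta> (W t)) \<in> C_0 L"
    using W by (auto simp: C_0_iff \<alpha>_def \<beta>_def bounded_operators_scaleR bounded_operators_id)
  moreover have "W = (\<lambda>t. \<alpha> (W t) o\<^sub>L \<beta> (W t)) \<and> (\<forall>t. W t = 0 \<longrightarrow> \<alpha> (W t) = 0 \<and> \<beta> (W t) = 0)"
    by (intro conjI ext blinfun_eqI) (simp_all add: \<alpha>_def \<beta>_def blinfun.scaleR_left blinfun.scaleR_right)
  ultimately show ?thesis by (intro bexI)
qed

lemma norm_le_sup_norm:
  assumes "bounded (F ` topspace L)" "t \<in> topspace L"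
  shows "norm (F t) \<le> sup_norm L F"
proof -
  obtain B where "\<And>s. s \<in> topspace L \<Longrightarrow> norm (F s) \<le> B"
    using assms(1) by (auto simp: bounded_iff)
  then have "bdd_above ((\<lambda>s. norm (F s)) ` topspace L)" by (rule bdd_aboveI2)
  then show ?thesis
    unfolding sup_norm_def using assms(2) by (intro cSup_upper) auto
qed

lemma sup_norm_le: "0 \<le> c \<Longrightarrow> (\<And>t. t \<in> topspace L \<Longrightarrow> norm (F t) \<le> c) \<Longrightarrow> sup_norm L F \<le> c"
  unfolding sup_norm_def by (rule cSup_least) auto

lemma sup_norm_0: "sup_norm L (\<lambda>t. 0) = 0"
proof -
  have "insert 0 ((\<lambda>t. norm (0 :: 'b \<Rightarrow>\<^sub>L 'b)) ` topspace L) = {0}" by auto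
  then show ?thesis unfolding sup_norm_def by (simp only: cSup_singleton)
qed

subsection \<open>Derivations\<close>

text \<open>A unit vector \<open>e\<close> exists only if H is nonzero; the zero space is treated
  separately in the final theorem.\<close>

locale C_0_derivation =
  fixes L :: "'l topology"
    and D :: "('l \<Rightarrow> 'h::chilbert_space \<Rightarrow>\<^sub>L 'h) \<Rightarrow> ('l \<Rightarrow> 'h \<Rightarrow>\<^sub>L 'h)"
    and e :: 'h
  assumes loc: "locally_compact_space L" and haus: "Hausdorff_space L"
    and deriv: "derivation_C_0 L D" and norm_e: "norm e = 1"
begin

lemma D_in: "X \<in> C_0 L \<Longrightarrow> D X \<in> C_0 L"
  and D_add: "X \<in> C_0 L \<Longrightarrow> Y \<in> C_0 L \<Longrightarrow> D (\<lambda>t. X t + Y t) = (\<lambda>t. D X t + D Y t)"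
  and D_scaleC: "X \<in> C_0 L \<Longrightarrow> D (\<lambda>t. scaleC_blinfun a (X t)) = (\<lambda>t. scaleC_blinfun a (D X t))"
  and D_mult: "X \<in> C_0 L \<Longrightarrow> Y \<in> C_0 L \<Longrightarrow>
      D (\<lambda>t. X t o\<^sub>L Y t) = (\<lambda>t. (D X t o\<^sub>L Y t) + (X t o\<^sub>L D Y t))"
  using deriv by (auto simp: derivation_C_0_def)

text \<open>The difference factors as A B with both factors 0 at \<open>t\<close>, so each summand
  of the product rule for D (A B) has a factor vanishing at \<open>t\<close>.\<close>

lemma D_local:
  assumes "X \<in> C_0 L" "Y \<in> C_0 L" "X t = Y t"
  shows "D X t = D Y t"
proof -
  define W where "W = (\<lambda>s. X s - Y s)"
  have W: "W \<in> C_0 L" unfolding W_def using assms C_0_diff by blast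
  obtain A B where AB: "A \<in> C_0 L" "B \<in> C_0 L" "W = (\<lambda>t. A t o\<^sub>L B t)"
    "\<forall>t. W t = 0 \<longrightarrow> A t = 0 \<and> B t = 0"
    using C_0_factorization[OF W] by blast
  have "A t = 0" "B t = 0" using AB(4) assms(3) by (simp_all add: W_def)
  then have "D W t = 0" using D_mult[OF AB(1,2)] AB(3) by simp
  moreover have "D X t = D W t + D Y t"
    using D_add[OF W assms(2)] by (simp add: W_def)
  ultimately show ?thesis by simp
qed

section \<open>The derivations of B(H) induced at the points of the space\<close>

definition bump :: "'l \<Rightarrow> 'l \<Rightarrow> real" where
  "bump t = (SOME f. vanishing_map L f \<and> f t = 1 \<and> (\<forall>s. 0 \<le> f s \<and> f s \<le> 1))"

lemma bump:
  assumes "t \<in> topspace L"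
  shows "vanishing_map L (bump t)" "bump t t = 1" "0 \<le> bump t s" "bump t s \<le> 1"
proof -
  have "\<exists>f::'l \<Rightarrow> real. vanishing_map L f \<and> f t = 1 \<and> (\<forall>s. 0 \<le> f s \<and> f s \<le> 1)"
    using ex_bump[OF loc haus assms] by metis
  from someI_ex[OF this] show "vanishing_map L (bump t)" "bump t t = 1" "0 \<le> bump t s" "bump t s \<le> 1"
    unfolding bump_def by auto
qed

text \<open>The derivation \<open>\<delta>\<^sub>t\<close> of the overview. For \<open>T\<close> in
  \<open>bounded_operators\<close>, \<open>D_local\<close> makes the value independent of the chosen
  bump.\<close>

definition fibre :: "'l \<Rightarrow> ('h \<Rightarrow>\<^sub>L 'h) \<Rightarrow> ('h \<Rightarrow>\<^sub>L 'h)" where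
  "fibre t T = D (\<lambda>s. bump t s *\<^sub>R T) t"

lemma bump_C_0: "t \<in> topspace L \<Longrightarrow> T \<in> bounded_operators \<Longrightarrow> (\<lambda>s. bump t s *\<^sub>R T) \<in> C_0 L"
  by (intro C_0_scaleR bump)

lemma D_fibre: "t \<in> topspace L \<Longrightarrow> X \<in> C_0 L \<Longrightarrow> D X t = fibre t (X t)"
  unfolding fibre_def
  by (rule D_local[OF _ bump_C_0[OF _ C_0_bounded_operators]]) (simp_all add: bump(2))

lemma fibre_add:
  assumes "t \<in> topspace L" "S \<in> bounded_operators" "T \<in> bounded_operators"
  shows "fibre t (S + T) = fibre t S + fibre t T"
  unfolding fibre_def scaleR_add_right
  by (subst D_add[OF bump_C_0[OF assms(1,2)] bump_C_0[OF assms(1,3)]]) simp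

lemma fibre_scaleC:
  assumes "t \<in> topspace L" "T \<in> bounded_operators"
  shows "fibre t (scaleC_blinfun a T) = scaleC_blinfun a (fibre t T)"
proof -
  have "r *\<^sub>R scaleC_blinfun a T = scaleC_blinfun a (r *\<^sub>R T)" for r
    by (rule blinfun_eqI) (simp add: scaleC_blinfun.rep_eq blinfun.scaleR_left scaleC_scaleR)
  then show ?thesis
    unfolding fibre_def by (simp add: D_scaleC[OF bump_C_0[OF assms]])
qed

lemma fibre_scaleR:
  "t \<in> topspace L \<Longrightarrow> T \<in> bounded_operators \<Longrightarrow> fibre t (r *\<^sub>R T) = r *\<^sub>R fibre t T"
  using fibre_scaleC[of t T "of_real r"] by (simp add: scaleC_blinfun_of_real)

text \<open>The product of the two extended operators carries the square of the bump, but it lies in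
  \<open>C_0\<close> and has value \<open>S o\<^sub>L T\<close> at \<open>t\<close>, which is all
  that \<open>D_fibre\<close> asks for.\<close>

lemma fibre_mult:
  assumes "t \<in> topspace L" "S \<in> bounded_operators" "T \<in> bounded_operators"
  shows "fibre t (S o\<^sub>L T) = (fibre t S o\<^sub>L T) + (S o\<^sub>L fibre t T)"
proof -
  let ?S = "\<lambda>s. bump t s *\<^sub>R S" and ?T = "\<lambda>s. bump t s *\<^sub>R T"
  have "(\<lambda>s. ?S s o\<^sub>L ?T s) = (\<lambda>s. (bump t s * bump t s) *\<^sub>R (S o\<^sub>L T))"
    by (intro ext blinfun_eqI) (simp add: blinfun.scaleR_left blinfun.scaleR_right)
  also have "\<dots> \<in> C_0 L"
    using vanishing_map_compose[OF bump(1)[OF assms(1)], of "\<lambda>r. r * r"] assms(2,3)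
    by (intro C_0_scaleR bounded_operators_compose) (simp_all add: continuous_on_mult)
  finally have "D (\<lambda>s. ?S s o\<^sub>L ?T s) t = fibre t (?S t o\<^sub>L ?T t)"
    using D_fibre assms(1) by blast
  moreover have "D (\<lambda>s. ?S s o\<^sub>L ?T s) t = (D ?S t o\<^sub>L ?T t) + (?S t o\<^sub>L D ?T t)"
    by (subst D_mult[OF bump_C_0[OF assms(1,2)] bump_C_0[OF assms(1,3)]]) simp
  ultimately show ?thesis
    using bump(2)[OF assms(1)] by (simp add: fibre_def)
qed

text \<open>A bump equal to 1 on a whole neighbourhood lets the single continuous function
  \<open>D X\<close> represent all nearby values \<open>fibre s T\<close>.\<close>

lemma fibre_continuous:
  assumes t: "t \<in> topspace L" and T: "T \<in> bounded_operators"
  shows "((\<lambda>s. fibre s T) \<longlongrightarrow> fibre t T) (atin L t)"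
proof -
  obtain f :: "'l \<Rightarrow> real" and U where f: "vanishing_map L f" "openin L U" "t \<in> U"
    "\<And>s. s \<in> U \<Longrightarrow> f s = 1"
    using ex_bump[OF loc haus t] by metis
  define X where "X = (\<lambda>s. f s *\<^sub>R T)"
  have X: "X \<in> C_0 L" unfolding X_def using f T by (intro C_0_scaleR)
  have eq: "D X s = fibre s T" if "s \<in> U" for s
    using D_fibre[OF _ X, of s] f(4)[OF that] openin_subset[OF f(2)] that by (auto simp: X_def)
  have "(D X \<longlongrightarrow> D X t) (atin L t)"
    using D_in[OF X] t by (auto simp: C_0_def continuous_map_atin)
  moreover have "\<forall>\<^sub>F s in atin L t. D X s = fibre s T"
    unfolding eventually_atin using f(2,3) eq by blast
  ultimately show ?thesis
    using eq[OF f(3)] by (auto intro: Lim_transform_eventually)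
qed

text \<open>If the values at points \<open>s\<^sub>n\<close> were larger than \<open>4\<^sup>n\<close>, then \<open>D\<close> would map
  \<open>f T\<close> to an unbounded function, where \<open>f = \<Sum>n. 2\<^sup>-\<^sup>n f\<^sub>n\<close> for bumps \<open>f\<^sub>n\<close> at \<open>s\<^sub>n\<close>.\<close>

lemma fibre_bounded:
  assumes T: "T \<in> bounded_operators"
  shows "\<exists>C. \<forall>t\<in>topspace L. norm (fibre t T) \<le> C"
proof (rule ccontr)
  assume "\<not> ?thesis"
  then have "\<exists>t\<in>topspace L. norm (fibre t T) > 4 ^ n" for n :: nat
    by (meson not_le)
  then obtain s where s: "\<And>n. s n \<in> topspace L" and big: "\<And>n::nat. norm (fibre (s n) T) > 4 ^ n"
    by metis
  define F where "F k t = (1/2) ^ k * bump (s k) t" for k t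
  have F0: "0 \<le> F k t" and F1: "F k t \<le> (1/2) ^ k" for k t
    using bump(3,4)[OF s[of k], of t] by (simp_all add: F_def mult_left_le)
  define f where "f t = (\<Sum>k. F k t)" for t
  have sm: "summable (\<lambda>k. F k t)" for t
    by (rule summable_comparison_test'[where g = "\<lambda>k. (1/2) ^ k"]) (use F0 F1 in \<open>auto simp: abs_le_iff\<close>)
  have "vanishing_map L f"
  proof (rule vanishing_map_uniform_limit)
    have "vanishing_map L (F k)" for k
      using vanishing_map_compose[OF bump(1)[OF s[of k]], of "\<lambda>r. (1/2) ^ k * r"]
      by (simp add: F_def[abs_def] continuous_on_mult_left)
    then show "vanishing_map L (\<lambda>t. \<Sum>k<n. F k t)" for n
      by (rule vanishing_map_sum)
    show "uniform_limit UNIV (\<lambda>n t. \<Sum>k<n. F k t) f sequentially"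
      unfolding f_def by (rule Weierstrass_m_test[where M = "\<lambda>k. (1/2) ^ k"])
        (use F0 F1 in \<open>auto simp: abs_le_iff\<close>)
  qed
  then have X: "(\<lambda>t. f t *\<^sub>R T) \<in> C_0 L" using T by (rule C_0_scaleR)
  then have "bounded (D (\<lambda>t. f t *\<^sub>R T) ` topspace L)"
    using D_in by (auto simp: C_0_iff intro: vanishing_map_bounded)
  then obtain B where B: "\<And>t. t \<in> topspace L \<Longrightarrow> norm (D (\<lambda>t. f t *\<^sub>R T) t) \<le> B"
    by (auto simp: bounded_iff)
  obtain n where n: "(2::real) ^ n > B" using real_arch_pow[of 2 B] by auto
  \<comment> \<open>Other bumps may overlap at \<open>s n\<close>, but all terms are nonnegative and
    can only increase the sum.\<close>
  have "F n (s n) \<le> f (s n)"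
    unfolding f_def using sum_le_suminf[OF sm, of "{n}"] F0 by simp
  then have fn: "(1/2) ^ n \<le> f (s n)" by (simp add: F_def bump(2)[OF s])
  have "(2::real) ^ n = (1/2) ^ n * 4 ^ n" by (simp add: power_mult_distrib[symmetric])
  also have "\<dots> \<le> f (s n) * norm (fibre (s n) T)"
    using fn big[of n] by (intro mult_mono) (auto intro: order_trans[OF _ fn])
  also have "\<dots> = norm (D (\<lambda>t. f t *\<^sub>R T) (s n))"
    using order_trans[OF _ fn, of 0] by (simp add: D_fibre[OF s X] fibre_scaleR[OF s T])
  also have "\<dots> \<le> B" by (rule B[OF s])
  finally show False using n by simp
qed

section \<open>Implementing the induced derivations by bounded operators\<close>

definition implement :: "'l \<Rightarrow> 'h \<Rightarrow> 'h" where
  "implement t x = fibre t (rank_one x e) e"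

lemma ee: "cinner e e = 1"
  by (simp add: cinner_norm norm_e)

text \<open>Apply the product rule to T (x \<otimes> e) = (T x) \<otimes> e and evaluate at
  \<open>e\<close>, using <e, e> = 1.\<close>

lemma fibre_implement:
  assumes "t \<in> topspace L" "T \<in> bounded_operators"
  shows "fibre t T x = implement t (T x) - T (implement t x)"
proof -
  have "implement t (T x) = fibre t (T o\<^sub>L rank_one x e) e"
    by (simp add: implement_def compose_rank_one[OF assms(2)])
  then show ?thesis
    by (simp add: fibre_mult[OF assms rank_one_bounded_operators] blinfun.add_left rank_one.rep_eq ee
        implement_def)
qed

lemma implement_add: "t \<in> topspace L \<Longrightarrow> implement t (x + y) = implement t x + implement t y"
  by (simp add: implement_def rank_one_add fibre_add rank_one_bounded_operators blinfun.add_left)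

lemma implement_scaleC: "t \<in> topspace L \<Longrightarrow> implement t (a *\<^sub>C x) = a *\<^sub>C implement t x"
  by (simp add: implement_def rank_one_scaleC fibre_scaleC rank_one_bounded_operators
      scaleC_blinfun.rep_eq)

text \<open>This is \<open>fibre_implement\<close> for the operator e \<otimes> h. It expresses
  matrix coefficients through values of \<open>fibre\<close>, which yields both the weak bounds and
  the continuity of the adjoints.\<close>

lemma implement_inner:
  assumes "t \<in> topspace L"
  shows "cinner (implement t x) h *\<^sub>C e = cinner x h *\<^sub>C implement t e - fibre t (rank_one e h) x"
  using fibre_implement[OF assms rank_one_bounded_operators, of e h x]
  by (simp add: rank_one.rep_eq implement_scaleC[OF assms])

text \<open>For fixed \<open>h\<close>, the bounds on \<open>fibre\<close> at e \<otimes> e and e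
  \<otimes> h control all coefficients <implement t x, h> with |x| \<le> 1. Uniform boundedness,
  applied to all \<open>t\<close> and \<open>x\<close> at once, then gives one constant for the
  whole space.\<close>

lemma implement_bounded: "\<exists>C\<ge>0. \<forall>t\<in>topspace L. \<forall>x. norm (implement t x) \<le> C * norm x"
proof -
  define V where "V = {implement t x |t x. t \<in> topspace L \<and> norm x \<le> 1}"
  have "bounded V"
  proof (rule weakly_bounded_imp_bounded)
    fix h
    obtain C1 where C1: "\<And>t. t \<in> topspace L \<Longrightarrow> norm (fibre t (rank_one e e)) \<le> C1"
      using fibre_bounded[OF rank_one_bounded_operators] by metis
    obtain C2 where C2: "\<And>t. t \<in> topspace L \<Longrightarrow> norm (fibre t (rank_one e h)) \<le> C2"
      using fibre_bounded[OF rank_one_bounded_operators] by metis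
    have "cmod (cinner (implement t x) h) \<le> norm h * C1 + C2" if t: "t \<in> topspace L" and x: "norm x \<le> 1" for t x
    proof -
      have "cmod (cinner (implement t x) h) = norm (cinner (implement t x) h *\<^sub>C e)"
        by (simp add: norm_scaleC norm_e)
      also have "\<dots> \<le> norm (cinner x h *\<^sub>C implement t e) + norm (fibre t (rank_one e h) x)"
        unfolding implement_inner[OF t] by (rule norm_triangle_ineq4)
      also have "norm (cinner x h *\<^sub>C implement t e) \<le> norm h * C1"
      proof -
        have "cmod (cinner x h) \<le> norm x * norm h" by (rule complex_Cauchy_Schwarz)
        also have "\<dots> \<le> norm h" using x by (simp add: mult_left_le_one_le)
        finally have "cmod (cinner x h) \<le> norm h" .
        moreover have "norm (implement t e) \<le> C1"
          using norm_blinfun[of "fibre t (rank_one e e)" e] C1[OF t] by (simp add: implement_def norm_e)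
        ultimately show ?thesis by (simp add: norm_scaleC mult_mono)
      qed
      also have "norm (fibre t (rank_one e h) x) \<le> C2"
      proof -
        have "norm (fibre t (rank_one e h) x) \<le> norm (fibre t (rank_one e h)) * norm x"
          by (rule norm_blinfun)
        also have "\<dots> \<le> norm (fibre t (rank_one e h))" using x by (simp add: mult_left_le)
        finally show ?thesis using C2[OF t] by simp
      qed
      finally show ?thesis by simp
    qed
    then show "\<exists>C. \<forall>v\<in>V. cmod (cinner v h) \<le> C" by (auto simp: V_def)
  qed
  then obtain C where "C > 0" and C: "\<And>v. v \<in> V \<Longrightarrow> norm v \<le> C" by (auto simp: bounded_pos)
  have "norm (implement t x) \<le> C * norm x" if t: "t \<in> topspace L" for t x
  proof (cases "x = 0")
    case True
    then show ?thesis using implement_scaleC[OF t, of 0 0] by simp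
  next
    case False
    have x: "x = of_real (norm x) *\<^sub>C sgn x" using False by (simp add: scaleC_of_real sgn_div_norm)
    have "implement t (sgn x) \<in> V"
      unfolding V_def using t by (intro CollectI exI[of _ t] exI[of _ "sgn x"]) (simp add: norm_sgn)
    then have "norm x * norm (implement t (sgn x)) \<le> norm x * C"
      by (intro mult_left_mono C) simp_all
    then show ?thesis
      by (subst x) (simp add: implement_scaleC[OF t] norm_scaleC mult.commute)
  qed
  then show ?thesis using \<open>C > 0\<close> by (intro exI[of _ C]) auto
qed

text \<open>\<open>Blinfun\<close> is meaningful here by \<open>implement_bounded\<close>; the value
  0 off the carrier follows the convention of \<open>C_b\<close>.\<close>

definition generator :: "'l \<Rightarrow> 'h \<Rightarrow>\<^sub>L 'h" where
  "generator t = (if t \<in> topspace L then Blinfun (implement t) else 0)"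

lemma generator_apply: "t \<in> topspace L \<Longrightarrow> generator t x = implement t x"
proof -
  assume t: "t \<in> topspace L"
  obtain C where C: "\<And>x. norm (implement t x) \<le> C * norm x" using implement_bounded t by blast
  have "bounded_linear (implement t)"
    by (rule bounded_linear_intro[where K = C])
      (simp_all add: implement_add[OF t] implement_scaleC[OF t] scaleC_of_real[symmetric] C mult.commute)
  then show ?thesis using t by (simp add: generator_def bounded_linear_Blinfun_apply)
qed

lemma generator_bounded: "\<exists>C\<ge>0. \<forall>t\<in>topspace L. norm (generator t) \<le> C"
proof -
  obtain C where "C \<ge> 0" "\<And>t x. t \<in> topspace L \<Longrightarrow> norm (implement t x) \<le> C * norm x"
    using implement_bounded by blast
  then show ?thesis by (intro exI[of _ C]) (auto intro!: norm_blinfun_bound simp: generator_apply)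
qed

lemma generator_bounded_operators: "generator t \<in> bounded_operators"
proof (cases "t \<in> topspace L")
  case True
  then show ?thesis by (simp add: bounded_operators_def generator_apply implement_scaleC)
qed (simp add: generator_def bounded_operators_0)

lemma fibre_generator:
  assumes "t \<in> topspace L" "T \<in> bounded_operators"
  shows "fibre t T = (generator t o\<^sub>L T) - (T o\<^sub>L generator t)"
  by (rule blinfun_eqI)
    (simp add: fibre_implement[OF assms] generator_apply[OF assms(1)] blinfun.diff_left)

section \<open>From strong continuity to norm continuity of the generator\<close>

lemma generator_strongly_continuous:
  assumes t: "t \<in> topspace L"
  shows "((\<lambda>s. generator s v) \<longlongrightarrow> generator t v) (atin L t)"
proof -
  have "((\<lambda>s. fibre s (rank_one v e) e) \<longlongrightarrow> fibre t (rank_one v e) e) (atin L t)"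
    by (intro blinfun.tendsto fibre_continuous t rank_one_bounded_operators tendsto_const)
  moreover have "\<forall>\<^sub>F s in atin L t. fibre s (rank_one v e) e = generator s v"
    unfolding eventually_atin using t by (intro disjI2 exI[of _ "topspace L"])
      (auto simp: generator_apply implement_def)
  ultimately have "((\<lambda>s. generator s v) \<longlongrightarrow> fibre t (rank_one v e) e) (atin L t)"
    by (rule Lim_transform_eventually)
  then show ?thesis by (simp add: generator_apply[OF t] implement_def)
qed

text \<open>Strong continuity of the adjoints, stated without adjoints: the bound for all
  \<open>x\<close> says that the adjoint of the difference maps \<open>v\<close> to a vector of norm
  at most \<delta>.\<close>

lemma generator_adjoint_strongly_continuous:
  assumes t: "t \<in> topspace L" and "\<delta> > 0"
  shows "\<forall>\<^sub>F s in atin L t. \<forall>x. cmod (cinner ((generator s - generator t) x) v) \<le> \<delta> * norm x"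
proof -
  \<comment> \<open>The factor of |x| obtained by subtracting \<open>implement_inner\<close> at
    \<open>t\<close> from that at \<open>s\<close>, with h = v.\<close>
  define q where "q s = norm v * norm (generator s e - generator t e)
    + norm (fibre s (rank_one e v) - fibre t (rank_one e v))" for s
  have "(q \<longlongrightarrow> norm v * norm (generator t e - generator t e)
      + norm (fibre t (rank_one e v) - fibre t (rank_one e v))) (atin L t)"
    unfolding q_def
    by (intro tendsto_intros generator_strongly_continuous[OF t] fibre_continuous[OF t]
        rank_one_bounded_operators)
  then have "(q \<longlongrightarrow> 0) (atin L t)" by simp
  then have "\<forall>\<^sub>F s in atin L t. q s < \<delta>" using \<open>\<delta> > 0\<close> by (rule order_tendstoD)
  moreover have "\<forall>\<^sub>F s in atin L t. s \<in> topspace L"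
    unfolding eventually_atin by blast
  ultimately show ?thesis
  proof eventually_elim
    case (elim s)
    show ?case
    proof
      fix x
      have "cinner ((generator s - generator t) x) v *\<^sub>C e
        = cinner x v *\<^sub>C (generator s e - generator t e) - (fibre s (rank_one e v) - fibre t (rank_one e v)) x"
      proof -
        have "cinner ((generator s - generator t) x) v *\<^sub>C e
          = cinner (implement s x) v *\<^sub>C e - cinner (implement t x) v *\<^sub>C e"
          by (simp add: blinfun.diff_left generator_apply elim t cinner_diff_left
              scaleC_add_left[of "_ - _" _, symmetric] eq_diff_eq)
        then show ?thesis
          by (simp add: implement_inner elim t blinfun.diff_left generator_apply scaleC_diff_right)
      qed
      then have "cmod (cinner ((generator s - generator t) x) v)
        \<le> norm (cinner x v *\<^sub>C (generator s e - generator t e))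
          + norm ((fibre s (rank_one e v) - fibre t (rank_one e v)) x)"
        by (metis norm_scaleC norm_e mult.right_neutral norm_triangle_ineq4)
      also have "norm (cinner x v *\<^sub>C (generator s e - generator t e))
        \<le> norm x * norm v * norm (generator s e - generator t e)"
        unfolding norm_scaleC by (intro mult_right_mono complex_Cauchy_Schwarz) simp
      also have "norm ((fibre s (rank_one e v) - fibre t (rank_one e v)) x)
        \<le> norm (fibre s (rank_one e v) - fibre t (rank_one e v)) * norm x"
        by (rule norm_blinfun)
      finally have "cmod (cinner ((generator s - generator t) x) v) \<le> q s * norm x"
        by (simp add: q_def algebra_simps)
      also have "\<dots> \<le> \<delta> * norm x" using elim by (intro mult_right_mono) auto
      finally show "cmod (cinner ((generator s - generator t) x) v) \<le> \<delta> * norm x" .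
    qed
  qed
qed

lemma generator_continuous: "continuous_map L euclidean generator"
  unfolding continuous_map_atin limitin_canonical_iff
proof (rule ballI, rule ccontr)
  fix t assume t: "t \<in> topspace L"
  assume "\<not> (generator \<longlongrightarrow> generator t) (atin L t)"
  then obtain \<epsilon> where "\<epsilon> > 0" and freq: "\<exists>\<^sub>F s in atin L t. dist (generator s) (generator t) \<ge> \<epsilon>"
    by (auto simp: tendsto_iff frequently_def not_le)
  obtain U K where K: "openin L U" "compactin L K" "t \<in> U" "U \<subseteq> K"
    using loc t unfolding locally_compact_space_def by blast
  have Ktop: "K \<subseteq> topspace L" using K(2) by (rule compactin_subset_topspace)
  define S where "S = (\<lambda>s. generator s - generator t) ` K"
  \<comment> \<open>Half of \<epsilon> is used because \<open>gliding_hump\<close> wants a strict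
    lower bound on the norms, while \<open>freq\<close> gives a weak one. The smallness condition
    holds near \<open>t\<close> for finitely many vectors at a time, so it meets \<open>freq\<close>
    inside \<open>K\<close>.\<close>
  obtain T Y where T: "T \<in> bounded_operators" and Y: "\<And>n::nat. Y n \<in> S"
    and sep: "\<And>n m. n < m \<Longrightarrow> norm (((Y n o\<^sub>L T) - (T o\<^sub>L Y n)) - ((Y m o\<^sub>L T) - (T o\<^sub>L Y m))) \<ge> \<epsilon> / 2 / 2"
  proof (rule gliding_hump[of "\<epsilon> / 2" S])
    show "\<epsilon> / 2 > 0" using \<open>\<epsilon> > 0\<close> by simp
    fix V :: "'h set" and \<delta> :: real
    assume "finite V" "\<delta> > 0"
    have "\<forall>\<^sub>F s in atin L t. norm ((generator s - generator t) v) \<le> \<delta>" for v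
      using tendstoD[OF generator_strongly_continuous[OF t] \<open>\<delta> > 0\<close>, of v]
      by (auto elim!: eventually_mono simp: dist_norm blinfun.diff_left)
    with generator_adjoint_strongly_continuous[OF t \<open>\<delta> > 0\<close>]
    have "\<forall>\<^sub>F s in atin L t. \<forall>v\<in>V. norm ((generator s - generator t) v) \<le> \<delta>
      \<and> (\<forall>x. cmod (cinner ((generator s - generator t) x) v) \<le> \<delta> * norm x)"
      using \<open>finite V\<close> by (intro eventually_ball_finite ballI eventually_conj)
    moreover have "\<forall>\<^sub>F s in atin L t. s \<in> K"
      unfolding eventually_atin using K by blast
    ultimately obtain s where "dist (generator s) (generator t) \<ge> \<epsilon>" "s \<in> K"
      "\<forall>v\<in>V. norm ((generator s - generator t) v) \<le> \<delta>
      \<and> (\<forall>x. cmod (cinner ((generator s - generator t) x) v) \<le> \<delta> * norm x)"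
      using frequently_ex[OF frequently_eventually_conj[OF freq eventually_conj]] by blast
    then show "\<exists>Y\<in>S. norm Y > \<epsilon> / 2 \<and> (\<forall>v\<in>V. norm (blinfun_apply Y v) \<le> \<delta> \<and>
        (\<forall>x. cmod (cinner (blinfun_apply Y x) v) \<le> \<delta> * norm x))"
      using \<open>\<epsilon> > 0\<close> unfolding S_def by (intro bexI[OF _ imageI]) (auto simp: dist_norm)
  qed (rule that)
  obtain s where s: "\<And>n. s n \<in> K" "\<And>n. Y n = generator (s n) - generator t"
  proof -
    have "\<forall>n. \<exists>s. s \<in> K \<and> Y n = generator s - generator t" using Y by (auto simp: S_def)
    then show ?thesis using that by metis
  qed
  have Yf: "(Y n o\<^sub>L T) - (T o\<^sub>L Y n) = fibre (s n) T - fibre t T" for n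
  proof -
    have "s n \<in> topspace L" using s Ktop by blast
    then show ?thesis
      by (intro blinfun_eqI)
        (simp add: fibre_generator[OF _ T] t s(2) blinfun.diff_left blinfun.diff_right)
  qed
  have "continuous_map L euclidean (\<lambda>s. fibre s T)"
    using fibre_continuous[OF _ T] by (simp add: continuous_map_atin)
  then have "compact ((\<lambda>s. fibre s T) ` K)"
    using image_compactin[OF K(2), of euclidean] by simp
  \<comment> \<open>The subsequence is extracted in the image, a compact subset of a normed space;
    \<open>K\<close> itself need not be sequentially compact.\<close>
  then obtain l r where r: "strict_mono (r :: nat \<Rightarrow> nat)"
    and lim: "((\<lambda>n. fibre (s n) T) \<circ> r) \<longlonglongrightarrow> l"
    using s(1) unfolding compact_def by (meson imageI)
  have "0 < \<epsilon> / 2 / 2" using \<open>\<epsilon> > 0\<close> by simp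
  from CauchyD[OF LIMSEQ_imp_Cauchy[OF lim] this]
  obtain N where "\<forall>m\<ge>N. \<forall>n\<ge>N. norm (fibre (s (r m)) T - fibre (s (r n)) T) < \<epsilon> / 2 / 2"
    unfolding o_def by blast
  then have "norm (fibre (s (r N)) T - fibre (s (r (Suc N))) T) < \<epsilon> / 2 / 2" by simp
  moreover have "r N < r (Suc N)" using r by (simp add: strict_mono_def)
  ultimately show False
    using sep[of "r N" "r (Suc N)"] by (simp add: Yf)
qed

lemma generator_C_b: "generator \<in> C_b L"
proof -
  obtain C where "\<forall>t\<in>topspace L. norm (generator t) \<le> C" using generator_bounded by blast
  then have "bounded (generator ` topspace L)" by (auto simp: bounded_iff)
  moreover have "generator t = 0" if "t \<notin> topspace L" for t using that by (simp add: generator_def)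
  ultimately show ?thesis
    by (auto simp: C_b_def generator_continuous generator_bounded_operators)
qed

lemma D_commutator:
  assumes X: "X \<in> C_0 L"
  shows "D X = commutator generator X"
proof
  fix t
  show "D X t = commutator generator X t"
  proof (cases "t \<in> topspace L")
    case True
    then show ?thesis
      by (simp add: D_fibre[OF True X] fibre_generator C_0_bounded_operators[OF X] commutator_def)
  next
    case False
    then have "D X t = 0" "X t = 0" using D_in[OF X] X by (auto simp: C_0_def)
    then show ?thesis by (simp add: commutator_def)
  qed
qed

section \<open>Boundedness of the derivation and the norm estimate\<close>

lemma bounded_C_0: "X \<in> C_0 L \<Longrightarrow> bounded (X ` topspace L)"
  by (simp add: C_0_iff vanishing_map_bounded)

text \<open>The real supremum dominates its members only for a set bounded above. The commutator
  formula supplies the bound 2 C, where C bounds the generator.\<close>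

lemma sup_norm_D_le_operator_norm:
  assumes "X \<in> C_0 L" "sup_norm L X \<le> 1"
  shows "sup_norm L (D X) \<le> operator_norm L D"
  unfolding operator_norm_def
proof (rule cSup_upper)
  obtain C where "C \<ge> 0" and C: "\<And>t. t \<in> topspace L \<Longrightarrow> norm (generator t) \<le> C"
    using generator_bounded by blast
  have "sup_norm L (D X) \<le> 2 * C" if X: "X \<in> C_0 L" "sup_norm L X \<le> 1" for X
  proof (rule sup_norm_le)
    fix t assume t: "t \<in> topspace L"
    have X1: "norm (X t) \<le> 1" using norm_le_sup_norm[OF bounded_C_0[OF X(1)] t] X(2) by simp
    have "norm (D X t) \<le> norm (generator t o\<^sub>L X t) + norm (X t o\<^sub>L generator t)"
      unfolding D_commutator[OF X(1)] commutator_def by (rule norm_triangle_ineq4)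
    also have "norm (generator t o\<^sub>L X t) \<le> C * 1"
      by (rule order_trans[OF norm_blinfun_compose]) (use C[OF t] X1 \<open>C \<ge> 0\<close> in \<open>intro mult_mono\<close>, auto)
    also have "norm (X t o\<^sub>L generator t) \<le> 1 * C"
      by (rule order_trans[OF norm_blinfun_compose]) (use C[OF t] X1 in \<open>intro mult_mono\<close>, auto)
    finally show "norm (D X t) \<le> 2 * C" by simp
  qed (use \<open>C \<ge> 0\<close> in simp)
  then show "bdd_above {sup_norm L (D X) |X. X \<in> C_0 L \<and> sup_norm L X \<le> 1}"
    by (intro bdd_aboveI[of _ "2 * C"]) auto
qed (use assms in blast)

lemma operator_norm_nonneg: "0 \<le> operator_norm L D"
proof -
  have 0: "(\<lambda>t. 0) \<in> C_0 L" by (auto simp: C_0_iff vanishing_map_0 bounded_operators_0)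
  have "D (\<lambda>t. 0) = (\<lambda>t. 0)" by (simp add: D_commutator[OF 0] commutator_def)
  then show ?thesis using sup_norm_D_le_operator_norm[OF 0] by (simp add: sup_norm_0)
qed

text \<open>For a unit vector \<open>x\<close>, \<open>generator t x\<close> is the value at the
  unit vector \<open>e\<close> of \<open>D ?X t\<close>, where \<open>?X\<close> is a bump times x
  \<otimes> e and has norm at most 1. This gives the constant 1.\<close>

lemma sup_norm_generator: "sup_norm L generator \<le> operator_norm L D"
proof (intro sup_norm_le operator_norm_nonneg)
  fix t assume t: "t \<in> topspace L"
  show "norm (generator t) \<le> operator_norm L D"
  proof (rule norm_blinfun_bound[OF operator_norm_nonneg])
    fix x
    have unit: "norm (generator t x) \<le> operator_norm L D" if "norm x = 1" for x
    proof -
      let ?X = "\<lambda>s. bump t s *\<^sub>R rank_one x e"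
      have X: "?X \<in> C_0 L" using t by (rule bump_C_0[OF _ rank_one_bounded_operators])
      have "norm (rank_one x e) \<le> 1" using norm_rank_one[of x e] by (simp add: that norm_e)
      then have "norm (?X s) \<le> 1" for s
        using bump(3,4)[OF t, of s] mult_mono[of "bump t s" 1 "norm (rank_one x e)" 1] by simp
      then have X1: "sup_norm L ?X \<le> 1" by (intro sup_norm_le) auto
      have "norm (generator t x) \<le> norm (D ?X t)"
        using norm_blinfun[of "D ?X t" e]
        by (simp add: generator_apply[OF t] implement_def fibre_def norm_e)
      also have "\<dots> \<le> sup_norm L (D ?X)"
        by (rule norm_le_sup_norm[OF bounded_C_0[OF D_in[OF X]] t])
      also have "\<dots> \<le> operator_norm L D" by (rule sup_norm_D_le_operator_norm[OF X X1])
      finally show ?thesis .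
    qed
    show "norm (generator t x) \<le> operator_norm L D * norm x"
    proof (cases "x = 0")
      case False
      then have x: "x = norm x *\<^sub>R sgn x" by (simp add: sgn_div_norm)
      have "norm (generator t (sgn x)) \<le> operator_norm L D"
        using False by (intro unit) (simp add: norm_sgn)
      then show ?thesis
        by (subst x) (simp add: blinfun.scaleR_right mult.commute mult_left_mono)
    qed simp
  qed
qed

end

theorem theorem3p9:
  fixes L :: "'l topology"
    and D :: "('l \<Rightarrow> 'h::chilbert_space \<Rightarrow>\<^sub>L 'h) \<Rightarrow> ('l \<Rightarrow> 'h \<Rightarrow>\<^sub>L 'h)"
  assumes "locally_compact_space L"
    and "Hausdorff_space L"
    and "derivation_C_0 L D"
  shows "\<exists>Z\<^sub>0 \<in> C_b L. sup_norm L Z\<^sub>0 \<le> 2 * operator_norm L D \<and>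
           (\<forall>X \<in> C_0 L. D X = commutator Z\<^sub>0 X)"
proof (cases "\<exists>x :: 'h. x \<noteq> 0")
  case True
  then obtain x :: 'h where "x \<noteq> 0" by blast
  interpret C_0_derivation L D "sgn x"
    using assms \<open>x \<noteq> 0\<close> by unfold_locales (simp_all add: norm_sgn)
  \<comment> \<open>The estimate with constant 1 implies the one with constant 2, as the operator
    norm is nonnegative.\<close>
  show ?thesis
    using generator_C_b D_commutator sup_norm_generator operator_norm_nonneg by force
next
  case False
  then have triv: "S = T" for S T :: "'h \<Rightarrow>\<^sub>L 'h" by (intro blinfun_eqI) metis
  have "sup_norm L F = 0" for F :: "'l \<Rightarrow> 'h \<Rightarrow>\<^sub>L 'h"
  proof -
    have "F = (\<lambda>t. 0)" by (intro ext triv)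
    then show ?thesis by (simp add: sup_norm_0)
  qed
  moreover have "(\<lambda>t. 0) \<in> (C_0 L :: ('l \<Rightarrow> 'h \<Rightarrow>\<^sub>L 'h) set)"
    by (auto simp: C_0_iff vanishing_map_0 bounded_operators_0)
  \<comment> \<open>The zero function makes this set nonempty, so its supremum is really 0.\<close>
  ultimately have "{sup_norm L (D X) |X. X \<in> C_0 L \<and> sup_norm L X \<le> 1} = {0}" by auto
  then have "operator_norm L D = 0" unfolding operator_norm_def by (simp only: cSup_singleton)
  moreover have "(\<lambda>t. 0) \<in> (C_b L :: ('l \<Rightarrow> 'h \<Rightarrow>\<^sub>L 'h) set)"
    by (auto simp: C_b_def bounded_operators_0 bounded_iff)
  ultimately show ?thesis
    using \<open>\<And>F. sup_norm L F = 0\<close> triv by (intro bexI[of _ "\<lambda>t. 0"]) auto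
qed

end
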